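(* Let $a,b\in\mathbb R\setminus\{0\}$ and, for $\omega\in\{\mathrm{os},\mathrm{oa},\mathrm{ea},\mathrm{es}\}$, consider the equation $$H_{a,b}(\mu_\omega^0)f=\mathfrak e_{\max}f\qquad( * )$$ for $f\in L^{1,\omega}(\mathbb T^2)$, where $\mu_\omega^0=\gamma_\omega/b$ for $\omega\in\{\mathrm{os},\mathrm{oa},\mathrm{ea}\}$ (when $b>0$) and $\mu_{\mathrm{es}}^0=\frac{a+4b}{ab}\gamma_{\mathrm{es}}$ (when $\frac{a+4b}{ab}>0$). (a) Assume that $b>0$ and $\omega\in\{\mathrm{os},\mathrm{oa}\}$. Then the function $$\Phi_\omega(p)=\begin{cases}\frac{\sin p_1+\sin p_2}{\mathfrak e_{\max}-\mathfrak e(p)} & \text{if }\omega=\mathrm{os},\\ \frac{\sin p_1-\sin p_2}{\mathfrak e_{\max}-\mathfrak e(p)} & \text{if }\omega=\mathrm{oa}\end{cases}$$ belongs to $L^{1,\omega}(\mathbb T^2)\setminus L^{2,\omega}(\mathbb T^2)$ and solves $( * )$. (b) Assume that $b>0$ and $\omega=\mathrm{ea}$. Then the function $$\Phi_{\mathrm{ea}}(p)=\frac{\cos p_1-\cos p_2}{\mathfrak e_{\max}-\mathfrak e(p)}$$ belongs to $L^{2,\mathrm{ea}}(\mathbb T^2)$ and solves $( * )$. (c) Assume that $\omega=\mathrm{es}$, $\frac{a+4b}{ab}>0$ and $\Theta^*a=\Theta^{**}b$. Then the function $$\Phi_{\mathrm{es}}(p)=\frac{2+\cos p_1+\cos p_2}{\mathfrak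 e_{\max}-\mathfrak e(p)}$$ belongs to $L^{2,\mathrm{es}}(\mathbb T^2)$ and solves $( * )$. (d) Assume that $\omega=\mathrm{es}$, $\frac{a+4b}{ab}>0$ and $\Theta^*a\ne\Theta^{**}b$. Then $( * )$ has only the zero solution in $L^{1,\mathrm{es}}(\mathbb T^2)$.
   Context: $\mathbb T^2=(-\pi,\pi]^2$ is the two-dimensional torus (dual group of $\mathbb Z^2$) and $\vec\pi=(\pi,\pi)$. Let $\hat{\mathfrak e}\in\ell^1(\mathbb Z^2)$ satisfy $\hat{\mathfrak e}(x)=\overline{\hat{\mathfrak e}(-x)}$ and let $\mathfrak e(p)=\sum_{x\in\mathbb Z^2}\hat{\mathfrak e}(x)e^{\mathrm i(p,x)}$. Standing assumption: $\mathfrak e$ is real-valued, even ($\mathfrak e(-p)=\mathfrak e(p)$), symmetric ($\mathfrak e(p_1,p_2)=\mathfrak e(p_2,p_1)$), has a unique maximum on $\mathbb T^2$, attained at $\vec\pi$ and non-degenerate (negative definite Hessian), and is real-analytic near $\vec\pi$. Put $\mathfrak e_{\max}=\max\mathfrak e$. For $\mu>0$ the operator $H_{a,b}(\mu)$, acting boundedly both in $L^2(\mathbb T^2)$ and in $L^1(\mathbb T^2)$, is $$H_{a,b}(\mu)f(p)=\mathfrak e(p)f(p)+\frac{\mu}{4\pi^2}\int_{\mathbb T^2}\Big(a+2b\sum_{i=1}^2\cos(p_i-q_i)\Big)f(q)\,dq.$$ For $r\in\{1,2\}$ the subspaces $L^{r,\omega}(\mathbb T^2)$, $\omega\in\{\mathrm{os},\mathrm{oa},\mathrm{ea},\mathrm{es}\}$,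 consist of those $f\in L^r(\mathbb T^2)$ that are (a.e.) odd and symmetric (os), odd and antisymmetric (oa), even and antisymmetric (ea), even and symmetric (es), where odd/even refers to $p\mapsto-p$ and symmetric/antisymmetric means $f(p_1,p_2)=\pm f(p_2,p_1)$. The following numbers are finite, and the $\gamma_\omega$ are positive: $$\gamma_{\mathrm{os}}=\Big(\tfrac1{4\pi^2}\int_{\mathbb T^2}\tfrac{(\sin q_1+\sin q_2)^2dq}{\mathfrak e_{\max}-\mathfrak e(q)}\Big)^{-1},\quad \gamma_{\mathrm{oa}}=\Big(\tfrac1{4\pi^2}\int_{\mathbb T^2}\tfrac{(\sin q_1-\sin q_2)^2dq}{\mathfrak e_{\max}-\mathfrak e(q)}\Big)^{-1},$$ $$\gamma_{\mathrm{ea}}=\Big(\tfrac1{4\pi^2}\int_{\mathbb T^2}\tfrac{(\cos q_1-\cos q_2)^2dq}{\mathfrak e_{\max}-\mathfrak e(q)}\Big)^{-1},\quad \gamma_{\mathrm{es}}=\Big(\tfrac1{4\pi^2}\int_{\mathbb T^2}\tfrac{(\cos q_1+\cos q_2+2)^2dq}{\mathfrak e_{\max}-\mathfrak e(q)}\Big)^{-1},$$ $$\Theta^*=\tfrac1{4\pi^2}\int_{\mathbb T^2}\tfrac{(2+\cos p_1+\cos p_2)dp}{\mathfrak e_{\max}-\mathfrak e(p)},\qquad \Theta^{**}=\tfrac1{4\pi^2}\int_{\mathbb T^2}\tfrac{2(\cos p_1+\cos p_2)(2+\cos p_1+\cos p_2)dp}{\mathfrak e_{\max}-\mathfrak e(p)}.$$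 *)

theory Defs
  imports "HOL-Analysis.Analysis"
begin

definition T2 :: "(real \<times> real) set" where
  "T2 = {-pi<..pi} \<times> {-pi<..pi}"

abbreviation torus :: "(real \<times> real) measure" where
  "torus \<equiv> lebesgue_on T2"

definition is_dispersion :: "(int \<times> int \<Rightarrow> complex) \<Rightarrow> (real \<times> real \<Rightarrow> real) \<Rightarrow> bool" where
  "is_dispersion ehat e \<longleftrightarrow>
     (\<lambda>x. norm (ehat x)) summable_on UNIV \<and>
     (\<forall>x. ehat x = cnj (ehat (- x))) \<and>
     (\<forall>p. complex_of_real (e p) =
        (\<Sum>\<^sub>\<infinity>x\<in>UNIV. ehat x *
           exp (\<i> * complex_of_real (fst p * of_int (fst x) + snd p * of_int (snd x)))))"

definition real_analytic_at :: "(real \<times> real \<Rightarrow> real) \<Rightarrow> real \<times> real \<Rightarrow> bool" where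
  "real_analytic_at f p0 \<longleftrightarrow>
     (\<exists>c r. r > 0 \<and> (\<forall>p\<in>ball p0 r.
        ((\<lambda>(m::nat, n::nat). c m n * (fst p - fst p0) ^ m * (snd p - snd p0) ^ n)
           has_sum f p) UNIV))"

definition real_analytic_near :: "(real \<times> real \<Rightarrow> real) \<Rightarrow> real \<times> real \<Rightarrow> bool" where
  "real_analytic_near f p0 \<longleftrightarrow>
     (\<exists>U. open U \<and> p0 \<in> U \<and> (\<forall>p\<in>U. real_analytic_at f p))"

definition partial1 :: "(real \<times> real \<Rightarrow> real) \<Rightarrow> real \<times> real \<Rightarrow> real" where
  "partial1 f p = deriv (\<lambda>t. f (t, snd p)) (fst p)"

definition partial2 :: "(real \<times> real \<Rightarrow> real) \<Rightarrow> real \<times> real \<Rightarrow> real" where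
  "partial2 f p = deriv (\<lambda>t. f (fst p, t)) (snd p)"

text \<open>The partial derivatives are only meaningful where they exist; this definition is used
  at a point near which the function is real-analytic.\<close>

definition hessian :: "(real \<times> real \<Rightarrow> real) \<Rightarrow> real \<times> real \<Rightarrow> real ^ 2 ^ 2" where
  "hessian f p = vector
     [vector [partial1 (partial1 f) p, partial1 (partial2 f) p],
      vector [partial2 (partial1 f) p, partial2 (partial2 f) p]]"

definition negative_definite :: "real ^ 'n ^ 'n \<Rightarrow> bool" where
  "negative_definite A \<longleftrightarrow> (\<forall>v. v \<noteq> 0 \<longrightarrow> v \<bullet> (A *v v) < 0)"

definition emax :: "(real \<times> real \<Rightarrow> real) \<Rightarrow> real" where
  "emax e = Sup (e ` T2)"

definition H_op :: "(real \<times> real \<Rightarrow> real) \<Rightarrow> real \<Rightarrow> real \<Rightarrow> real \<Rightarrow>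
    (real \<times> real \<Rightarrow> complex) \<Rightarrow> real \<times> real \<Rightarrow> complex" where
  "H_op e a b \<mu> f p = complex_of_real (e p) * f p +
     complex_of_real (\<mu> / (4 * pi\<^sup>2)) *
       (LINT q|torus. complex_of_real
          (a + 2 * b * (cos (fst p - fst q) + cos (snd p - snd q))) * f q)"

definition Lr :: "nat \<Rightarrow> (real \<times> real \<Rightarrow> complex) set" where
  "Lr r = {f. f \<in> borel_measurable torus \<and> integrable torus (\<lambda>p. norm (f p) ^ r)}"

datatype sector = OS | OA | EA | ES

fun parity_sign :: "sector \<Rightarrow> complex" where
  "parity_sign OS = - 1"
| "parity_sign OA = - 1"
| "parity_sign EA = 1"
| "parity_sign ES = 1"

fun swap_sign :: "sector \<Rightarrow> complex" where
  "swap_sign OS = 1"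
| "swap_sign OA = - 1"
| "swap_sign EA = - 1"
| "swap_sign ES = 1"

text \<open>Elements of the \<open>L\<^sup>r\<close> spaces are represented by functions, without passing to
  almost-everywhere classes. The group inverse of the torus is computed modulo \<open>2\<pi>\<close>; on
  \<open>T2\<close> it agrees with \<open>- p\<close> except on a null set, where a coordinate equals \<open>\<pi>\<close>.\<close>

definition Lr_sector :: "nat \<Rightarrow> sector \<Rightarrow> (real \<times> real \<Rightarrow> complex) set" where
  "Lr_sector r \<omega> = {f \<in> Lr r.
     (AE p in torus. f (- p) = parity_sign \<omega> * f p) \<and>
     (AE p in torus. f p = swap_sign \<omega> * f (snd p, fst p))}"

fun profile :: "sector \<Rightarrow> real \<times> real \<Rightarrow> real" where
  "profile OS q = sin (fst q) + sin (snd q)"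
| "profile OA q = sin (fst q) - sin (snd q)"
| "profile EA q = cos (fst q) - cos (snd q)"
| "profile ES q = cos (fst q) + cos (snd q) + 2"

definition gam :: "(real \<times> real \<Rightarrow> real) \<Rightarrow> sector \<Rightarrow> real" where
  "gam e \<omega> = inverse (1 / (4 * pi\<^sup>2) *
     (LINT q|torus. (profile \<omega> q)\<^sup>2 / (emax e - e q)))"

definition Theta1 :: "(real \<times> real \<Rightarrow> real) \<Rightarrow> real" where
  "Theta1 e = 1 / (4 * pi\<^sup>2) *
     (LINT p|torus. (2 + cos (fst p) + cos (snd p)) / (emax e - e p))"

definition Theta2 :: "(real \<times> real \<Rightarrow> real) \<Rightarrow> real" where
  "Theta2 e = 1 / (4 * pi\<^sup>2) *
     (LINT p|torus. 2 * (cos (fst p) + cos (snd p)) * (2 + cos (fst p) + cos (snd p))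
        / (emax e - e p))"

fun mu0 :: "(real \<times> real \<Rightarrow> real) \<Rightarrow> real \<Rightarrow> real \<Rightarrow> sector \<Rightarrow> real" where
  "mu0 e a b OS = gam e OS / b"
| "mu0 e a b OA = gam e OA / b"
| "mu0 e a b EA = gam e EA / b"
| "mu0 e a b ES = (a + 4 * b) / (a * b) * gam e ES"

definition threshold_solution :: "(real \<times> real \<Rightarrow> real) \<Rightarrow> real \<Rightarrow> real \<Rightarrow> sector \<Rightarrow>
    (real \<times> real \<Rightarrow> complex) \<Rightarrow> bool" where
  "threshold_solution e a b \<omega> f \<longleftrightarrow> f \<in> Lr_sector 1 \<omega> \<and>
     (AE p in torus. H_op e a b (mu0 e a b \<omega>) f p = complex_of_real (emax e) * f p)"

text \<open>At \<open>(\<pi>, \<pi>)\<close> the denominator vanishes and the quotient is \<open>0\<close> by convention; this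
  affects a single point only.\<close>

definition Phi :: "(real \<times> real \<Rightarrow> real) \<Rightarrow> sector \<Rightarrow> real \<times> real \<Rightarrow> complex" where
  "Phi e \<omega> p = complex_of_real (profile \<omega> p / (emax e - e p))"

end

theory Submission
  imports Defs
begin

text \<open>
  Write \<open>D = emax e - e\<close> for the gap and \<open>w = 2 + cos p1 + cos p2\<close>, which is \<open>profile ES\<close>. The
  threshold equation says that \<open>D f\<close> equals the interaction applied to \<open>f\<close>, and by the addition theorem the
  right-hand side is a trigonometric polynomial whose coefficients are moments of \<open>f\<close>
  (\<open>kernel_expansion\<close>). So every solution is a trigonometric polynomial divided by \<open>D\<close>, and two
  questions remain: which of these quotients are integrable, and whether the moments of the quotient
  reproduce the coefficients.

  For the first question, \<open>D\<close> is comparable to \<open>w\<close> (\<open>gap_comparison\<close>): both are positive off \<open>(pi, pi)\<close> and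
  vanish quadratically there, \<open>D\<close> because its power series at the maximum begins with a definite
  quadratic form. Near that point \<open>w\<close> is comparable to the squared distance \<open>r\<^sup>2\<close>. Consequently the even
  profiles, which are at most \<open>w\<close>, give bounded quotients (\<open>even_profile_bound\<close>); the odd profiles vanish
  to first order, so their quotients are of order \<open>1 / r\<close>, which is integrable in the plane
  (\<open>inverse_sqrt_profile_ES_integrable\<close>) but not square integrable (\<open>Phi_not_L2_odd\<close>); and \<open>1 / D\<close> is of order
  \<open>1 / r\<^sup>2\<close>, which is not integrable (\<open>inverse_profile_ES_not_integrable\<close>).

  For the second question, parity and symmetry kill most moments. In the sectors \<open>OS\<close>, \<open>OA\<close>, \<open>EA\<close> the
  interaction has rank one (\<open>kernel_on_sector\<close>), and \<open>gam\<close> is by definition the constant for which \<open>Phi\<close> is a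
  fixed point (\<open>Phi_solution\<close>). In the sector \<open>ES\<close> the interaction has rank two (\<open>kernel_on_ES\<close>). Since \<open>1 / D\<close>
  is not integrable, the numerator of a solution vanishes at \<open>(pi, pi)\<close>, which leaves the multiples of \<open>Phi e ES\<close>;
  the two moment equations are compatible with a nonzero multiple exactly when
  \<open>Theta1 e * a = Theta2 e * b\<close> (\<open>Phi_ES_solution\<close>, \<open>only_zero_solution\<close>).
\<close>

section \<open>Symmetries of the torus measure\<close>

lemma distr_lborel_reflect:
  "distr lborel borel uminus = (lborel :: (real \<times> real) measure)"
proof (rule lborel_eqI[symmetric])
  fix l u :: "real \<times> real"
  assume lu: "\<And>b. b \<in> Basis \<Longrightarrow> l \<bullet> b \<le> u \<bullet> b"
  have "uminus -` box l u = box (- u) (- l)"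
    by (force simp: box_def)
  then show "emeasure (distr lborel borel uminus) (box l u) = (\<Prod>b\<in>Basis. (u - l) \<bullet> b)"
    using lu by (subst emeasure_distr) (auto simp: emeasure_lborel_box inner_diff_left)
qed simp

lemma distr_lborel_swap:
  "distr lborel borel (\<lambda>p. (snd p, fst p)) = (lborel :: (real \<times> real) measure)"
proof (rule lborel_eqI[symmetric])
  fix l u :: "real \<times> real"
  assume lu: "\<And>b. b \<in> Basis \<Longrightarrow> l \<bullet> b \<le> u \<bullet> b"
  have eq: "(\<lambda>p. (snd p, fst p)) -` box l u = box (snd l, fst l) (snd u, fst u)"
    by (cases l; cases u) (auto simp: box_def Basis_prod_def)
  have m: "(\<lambda>p::real\<times>real. (snd p, fst p)) \<in> borel_measurable lborel"
    by (auto intro!: borel_measurable_continuous_onI continuous_intros)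
  have "l \<bullet> (1,0) \<le> u \<bullet> (1,0)" "l \<bullet> (0,1) \<le> u \<bullet> (0,1)"
    by (auto intro!: lu simp: Basis_prod_def)
  then have le: "fst l \<le> fst u" "snd l \<le> snd u"
    by (auto simp: inner_prod_def)
  have le2: "\<And>b. b \<in> Basis \<Longrightarrow> (snd l, fst l) \<bullet> b \<le> (snd u, fst u) \<bullet> b"
    using le by (auto simp: Basis_prod_def)
  have "emeasure (distr lborel borel (\<lambda>p. (snd p, fst p))) (box l u) =
     emeasure lborel (box (snd l, fst l) (snd u, fst u))"
    by (subst emeasure_distr) (use m eq in auto)
  also have "\<dots> = (\<Prod>b\<in>Basis. ((snd u, fst u) - (snd l, fst l)) \<bullet> b)"
    using le2 by (rule emeasure_lborel_box)
  also have "(\<Prod>b\<in>Basis. ((snd u, fst u) - (snd l, fst l)) \<bullet> b) = (\<Prod>b\<in>Basis. (u - l) \<bullet> b)"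
    by (cases l; cases u) (simp add: Basis_prod_def prod.union_disjoint prod.reindex inj_on_def
        image_iff disjoint_iff)
  finally show "emeasure (distr lborel borel (\<lambda>p. (snd p, fst p))) (box l u)
      = (\<Prod>b\<in>Basis. (u - l) \<bullet> b)" .
qed simp

text \<open>Functions in \<open>L\<^sup>1\<close> of the torus are only Lebesgue measurable, so the invariance of Lebesgue measure
  on the Borel sets has to be carried over to its completion: a Borel map that preserves the measure
  also preserves null sets.\<close>

lemma distr_lebesgue:
  fixes T :: "real \<times> real \<Rightarrow> real \<times> real"
  assumes T: "T \<in> borel_measurable borel" and D: "distr lborel borel T = lborel"
  shows "T \<in> lebesgue \<rightarrow>\<^sub>M lebesgue" and "distr lebesgue lebesgue T = lebesgue"
proof -
  have T': "T \<in> lborel \<rightarrow>\<^sub>M lborel" using T by simp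
  have TL: "T \<in> lebesgue \<rightarrow>\<^sub>M lborel" using T' by (rule measurable_completion)
  have D': "distr lborel lborel T = lborel"
    using D by (metis distr_cong sets_lborel)
  have DL: "distr lebesgue lborel T = lborel"
    using T' D' by (simp add: distr_completion)
  show TLL: "T \<in> lebesgue \<rightarrow>\<^sub>M lebesgue"
    using completion.complete_measure_axioms TL
    by (rule complete_measure.measurable_completion2) (simp add: DL)
  show "distr lebesgue lebesgue T = lebesgue"
    using completion.completion_distr_eq[OF TL] by (simp add: DL)
qed

lemma T2_measurable: "T2 \<in> sets lborel"
  unfolding T2_def by (simp add: borel_Times)

lemma T2_lebesgue [measurable]: "T2 \<in> sets lebesgue"
  using T2_measurable by auto

lemma AE_off_edges: "AE p in (lebesgue :: (real \<times> real) measure). fst p \<noteq> c \<and> snd p \<noteq> c"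
proof -
  have "negligible {p :: real \<times> real. p \<bullet> (1,0) = c}" "negligible {p :: real \<times> real. p \<bullet> (0,1) = c}"
    by (rule negligible_standard_hyperplane; simp add: Basis_prod_def)+
  then have "AE p in (lebesgue :: (real \<times> real) measure). p \<notin> {p. p \<bullet> (1,0) = c}"
    "AE p in (lebesgue :: (real \<times> real) measure). p \<notin> {p. p \<bullet> (0,1) = c}"
    by (simp_all only: negligible_iff_null_sets AE_not_in)
  then show ?thesis
    by eventually_elim (auto simp: inner_prod_def)
qed

lemma AE_torus_iff: "(AE p in torus. P p) \<longleftrightarrow> (AE p in lebesgue. p \<in> T2 \<longrightarrow> P p)"
  by (rule AE_restrict_space_iff) (simp add: T2_lebesgue)

text \<open>The set \<open>T2\<close> is half open, so the reflection at the origin does not map it to itself; it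
  does so off the edges, which are null. They also contain the point \<open>(pi, pi)\<close>, where the gap
  vanishes and the quotients of the threshold problem take the value \<open>0\<close> of division by zero.\<close>

lemma AE_torus_off_edges: "AE p in torus. \<bar>fst p\<bar> < pi \<and> \<bar>snd p\<bar> < pi"
proof -
  have "AE p in lebesgue. p \<in> T2 \<longrightarrow> \<bar>fst p\<bar> < pi \<and> \<bar>snd p\<bar> < pi"
    using AE_off_edges[of pi] by eventually_elim (auto simp: T2_def)
  then show ?thesis by (subst AE_torus_iff)
qed

text \<open>Parity and symmetry of the elements of a sector hold almost everywhere only. Substitution under
  the integral turns them into relations between integrals; the measurability of the substituted
  function is part of the conclusion because the comparison of integrals of functions that agree
  almost everywhere needs it.\<close>

lemma torus_compose:
  fixes T :: "real \<times> real \<Rightarrow> real \<times> real" and h :: "real \<times> real \<Rightarrow> complex"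
  assumes T: "T \<in> borel_measurable borel" "distr lborel borel T = lborel"
    and invariant: "AE p in lebesgue. T p \<in> T2 \<longleftrightarrow> p \<in> T2"
    and h: "h \<in> borel_measurable torus"
  shows "(\<lambda>p. h (T p)) \<in> borel_measurable torus"
    and "(LINT p|torus. h (T p)) = (LINT p|torus. h p)"
proof -
  note TL = distr_lebesgue[OF T]
  let ?g = "\<lambda>p. indicator T2 p *\<^sub>R h p"
  have g: "?g \<in> borel_measurable lebesgue"
    using h by (subst (asm) borel_measurable_restrict_space_iff) auto
  have gT: "(\<lambda>p. ?g (T p)) \<in> borel_measurable lebesgue"
    by (rule measurable_compose[OF TL(1) g])
  have eq: "AE p in lebesgue. indicator T2 p *\<^sub>R h (T p) = ?g (T p)"
    using invariant by eventually_elim (auto simp: indicator_def)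
  have m: "(\<lambda>p. indicator T2 p *\<^sub>R h (T p)) \<in> borel_measurable lebesgue"
    by (rule borel_measurable_AE[OF gT]) (use eq in eventually_elim, auto)
  then show "(\<lambda>p. h (T p)) \<in> borel_measurable torus"
    by (subst borel_measurable_restrict_space_iff) auto
  have "(LINT p|torus. h (T p)) = (LINT p|lebesgue. indicator T2 p *\<^sub>R h (T p))"
    by (subst integral_restrict_space) auto
  also have "\<dots> = (LINT p|lebesgue. ?g (T p))"
    using m gT eq by (intro integral_cong_AE)
  also have "\<dots> = (LINT p|distr lebesgue lebesgue T. ?g p)"
    using TL(1) g by (intro integral_distr[symmetric]) auto
  also have "\<dots> = (LINT p|torus. h p)"
    unfolding TL(2) by (subst integral_restrict_space) auto
  finally show "(LINT p|torus. h (T p)) = (LINT p|torus. h p)" .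
qed

lemma torus_reflect:
  fixes h :: "real \<times> real \<Rightarrow> complex"
  assumes "h \<in> borel_measurable torus"
  shows "(\<lambda>p. h (- p)) \<in> borel_measurable torus"
    and "(LINT p|torus. h (- p)) = (LINT p|torus. h p)"
proof -
  have invariant: "AE p in lebesgue. - p \<in> T2 \<longleftrightarrow> p \<in> T2"
    using AE_off_edges[of pi] AE_off_edges[of "-pi"] by eventually_elim (auto simp: T2_def)
  show "(\<lambda>p. h (- p)) \<in> borel_measurable torus"
    and "(LINT p|torus. h (- p)) = (LINT p|torus. h p)"
    by (rule torus_compose[OF _ distr_lborel_reflect invariant assms]; simp)+
qed

lemma torus_swap:
  fixes h :: "real \<times> real \<Rightarrow> complex"
  assumes "h \<in> borel_measurable torus"
  shows "(\<lambda>p. h (snd p, fst p)) \<in> borel_measurable torus"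
    and "(LINT p|torus. h (snd p, fst p)) = (LINT p|torus. h p)"
proof -
  have T: "(\<lambda>p::real\<times>real. (snd p, fst p)) \<in> borel_measurable borel"
    by (intro borel_measurable_continuous_onI continuous_intros)
  have invariant: "AE p in lebesgue. (snd p, fst p) \<in> T2 \<longleftrightarrow> p \<in> T2"
    by (auto simp: T2_def)
  show "(\<lambda>p. h (snd p, fst p)) \<in> borel_measurable torus"
    and "(LINT p|torus. h (snd p, fst p)) = (LINT p|torus. h p)"
    by (rule torus_compose[OF T distr_lborel_swap invariant assms])+
qed

section \<open>Power series in two variables\<close>

lemma dispersion_continuous:
  assumes "is_dispersion ehat e"
  shows "continuous_on UNIV e"
proof -
  let ?t = "\<lambda>x p. ehat x * exp (\<i> * complex_of_real (fst p * of_int (fst x) + snd p * of_int (snd x)))"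
  have s: "(\<lambda>x. norm (ehat x)) summable_on UNIV"
    and e: "\<And>p. complex_of_real (e p) = (\<Sum>\<^sub>\<infinity>x\<in>UNIV. ?t x p)"
    using assms by (auto simp: is_dispersion_def)
  have "uniform_limit UNIV (\<lambda>X p. \<Sum>x\<in>X. ?t x p) (\<lambda>p. \<Sum>\<^sub>\<infinity>x\<in>UNIV. ?t x p)
      (finite_subsets_at_top UNIV)"
    by (rule Weierstrass_m_test_general[OF _ s]) (simp add: norm_mult)
  then have "continuous_on UNIV (\<lambda>p. \<Sum>\<^sub>\<infinity>x\<in>UNIV. ?t x p)"
    by (rule uniform_limit_theorem[rotated]) (auto intro!: continuous_intros always_eventually)
  then have "continuous_on UNIV (\<lambda>p. Re (complex_of_real (e p)))"
    unfolding e by (rule continuous_on_Re)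
  then show ?thesis by simp
qed

text \<open>The maximum point \<open>(pi, pi)\<close> is a corner of \<open>T2\<close>, so three quarters of each of its
  neighbourhoods lie outside. Periodicity gives access to them.\<close>

lemma dispersion_periodic:
  assumes "is_dispersion ehat e"
  shows "e (p1 + 2 * pi * of_int k, p2 + 2 * pi * of_int l) = e (p1, p2)"
proof -
  let ?t = "\<lambda>p x. ehat x * exp (\<i> * complex_of_real (fst p * of_int (fst x) + snd p * of_int (snd x)))"
  have e: "\<And>p. complex_of_real (e p) = (\<Sum>\<^sub>\<infinity>x\<in>UNIV. ?t p x)"
    using assms by (auto simp: is_dispersion_def)
  have "?t (p1 + 2 * pi * of_int k, p2 + 2 * pi * of_int l) x = ?t (p1, p2) x" for x
  proof -
    have "\<i> * complex_of_real ((p1 + 2 * pi * of_int k) * of_int (fst x) + (p2 + 2 * pi * of_int l) * of_int (snd x))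
      = \<i> * complex_of_real (p1 * of_int (fst x) + p2 * of_int (snd x))
        + 2 * of_int (k * fst x + l * snd x) * complex_of_real pi * \<i>"
      by (simp add: algebra_simps)
    also have "exp \<dots> = exp (\<i> * complex_of_real (p1 * of_int (fst x) + p2 * of_int (snd x)))"
      using exp_plus_2pin[of _ "k * fst x + l * snd x"] by (simp add: mult_ac)
    finally show ?thesis by simp
  qed
  then have "complex_of_real (e (p1 + 2 * pi * of_int k, p2 + 2 * pi * of_int l)) = complex_of_real (e (p1, p2))"
    by (simp only: e)
  then show ?thesis by (simp only: of_real_eq_iff)
qed

lemma power_series_deriv:
  fixes b :: "nat \<Rightarrow> real"
  assumes sums: "\<And>t. \<bar>t - t0\<bar> < r \<Longrightarrow> (\<lambda>n. b n * (t - t0) ^ n) sums g t"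
    and t: "\<bar>t - t0\<bar> < r"
  shows "(\<lambda>n. diffs b n * (t - t0) ^ n) sums deriv g t"
proof -
  let ?h = "\<lambda>x. g (t0 + x)"
  have s: "\<And>x. norm x < r \<Longrightarrow> (\<lambda>n. b n * x ^ n) sums ?h x"
    using sums[of "t0 + x" for x] by simp
  have "((\<lambda>z. \<Sum>n. b n * z ^ n) has_field_derivative (\<Sum>n. diffs b n * (t - t0) ^ n)) (at (t - t0))"
    by (rule termdiffs_strong'[of r]) (use s t in \<open>auto simp: sums_iff\<close>)
  then have "(?h has_field_derivative (\<Sum>n. diffs b n * (t - t0) ^ n)) (at (t - t0))"
    by (rule has_field_derivative_transform_within_open[of _ _ _ "ball 0 r"])
      (use s t in \<open>auto simp: sums_iff dist_norm\<close>)
  then have D: "(g has_field_derivative (\<Sum>n. diffs b n * (t - t0) ^ n)) (at t)"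
    using DERIV_shift[of g _ "t - t0" t0] by (simp add: add.commute)
  have "summable (\<lambda>n. diffs b n * (t - t0) ^ n)"
    by (rule termdiff_converges[of _ r]) (use s t in \<open>auto simp: sums_iff\<close>)
  then show ?thesis
    using DERIV_imp_deriv[OF D] by (simp add: summable_sums)
qed

lemma power_series_deriv_centre:
  fixes b :: "nat \<Rightarrow> real"
  assumes "\<And>t. \<bar>t - t0\<bar> < r \<Longrightarrow> (\<lambda>n. b n * (t - t0) ^ n) sums g t" and "r > 0"
  shows "deriv g t0 = b 1"
proof -
  have "(\<lambda>n. diffs b n * 0 ^ n) sums deriv g t0"
    using power_series_deriv[of t0 r b g t0] assms by simp
  then show ?thesis
    by (simp add: diffs_def)
qed

text \<open>Summability on a square instead of a disc: on a square the two variables can be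
  moved independently, so the double series can be summed row by row.\<close>

definition double_power_series ::
    "(nat \<Rightarrow> nat \<Rightarrow> real) \<Rightarrow> real \<Rightarrow> (real \<times> real \<Rightarrow> real) \<Rightarrow> real \<times> real \<Rightarrow> bool" where
  "double_power_series c r f p0 \<longleftrightarrow> r > 0 \<and> (\<forall>x y. \<bar>x\<bar> < r \<longrightarrow> \<bar>y\<bar> < r \<longrightarrow>
     ((\<lambda>(m, n). c m n * x ^ m * y ^ n) has_sum f (fst p0 + x, snd p0 + y)) UNIV)"

lemma real_analytic_at_imp_double_power_series:
  assumes "real_analytic_at f p0"
  obtains c r where "double_power_series c r f p0"
proof -
  obtain c r where r: "r > 0" and S: "\<And>p. p \<in> ball p0 r \<Longrightarrow>
      ((\<lambda>(m::nat, n::nat). c m n * (fst p - fst p0) ^ m * (snd p - snd p0) ^ n) has_sum f p) UNIV"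
    using assms unfolding real_analytic_at_def by blast
  have "double_power_series c (r / 2) f p0"
    unfolding double_power_series_def
  proof (intro conjI allI impI)
    fix x y :: real assume xy: "\<bar>x\<bar> < r / 2" "\<bar>y\<bar> < r / 2"
    have "dist p0 (fst p0 + x, snd p0 + y) = norm (x, y)"
      by (cases p0) (simp add: dist_norm norm_Pair)
    also have "\<dots> \<le> \<bar>x\<bar> + \<bar>y\<bar>"
      using norm_Pair_le[of x y] by simp
    finally show "((\<lambda>(m, n). c m n * x ^ m * y ^ n) has_sum f (fst p0 + x, snd p0 + y)) UNIV"
      using S[of "(fst p0 + x, snd p0 + y)"] xy by simp
  qed (use r in simp)
  then show thesis by (rule that)
qed

lemma double_power_series_swap:
  assumes "double_power_series c r f p0"
  shows "double_power_series (\<lambda>m n. c n m) r (\<lambda>p. f (snd p, fst p)) (snd p0, fst p0)"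
  unfolding double_power_series_def
proof (intro conjI allI impI)
  fix x y :: real assume "\<bar>x\<bar> < r" "\<bar>y\<bar> < r"
  then have "((\<lambda>(m, n). c m n * y ^ m * x ^ n) has_sum f (fst p0 + y, snd p0 + x)) (UNIV \<times> UNIV)"
    using assms by (simp add: double_power_series_def)
  then show "((\<lambda>(m, n). c n m * x ^ m * y ^ n) has_sum
      f (snd (fst (snd p0, fst p0) + x, snd (snd p0, fst p0) + y),
         fst (fst (snd p0, fst p0) + x, snd (snd p0, fst p0) + y))) UNIV"
    by (subst (asm) has_sum_swap) (simp add: mult_ac case_prod_unfold)
qed (use assms in \<open>simp add: double_power_series_def\<close>)

text \<open>For fixed \<open>y\<close> the double series is a power series in the first variable, with the
  inner sums as coefficients. Theorems on one-variable power series then apply.\<close>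

lemma double_power_series_row:
  assumes "double_power_series c r f p0" and y: "\<bar>y\<bar> < r" and t: "\<bar>t - fst p0\<bar> < r"
  shows "(\<lambda>m. (\<Sum>\<^sub>\<infinity>n. c m n * y ^ n) * (t - fst p0) ^ m) sums f (t, snd p0 + y)"
proof -
  let ?x = "t - fst p0"
  have S: "((\<lambda>(m, n). c m n * ?x ^ m * y ^ n) has_sum f (fst p0 + ?x, snd p0 + y)) UNIV"
    using assms unfolding double_power_series_def by blast
  have sm: "(\<lambda>(m, n). c m n * ?x ^ m * y ^ n) summable_on Sigma UNIV (\<lambda>_. UNIV)"
    using has_sum_imp_summable[OF S] by simp
  have "(\<lambda>m. \<Sum>\<^sub>\<infinity>n. c m n * ?x ^ m * y ^ n) summable_on UNIV"
    by (rule summable_on_Sigma_banach[OF sm])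
  moreover have "(\<Sum>\<^sub>\<infinity>m. \<Sum>\<^sub>\<infinity>n. c m n * ?x ^ m * y ^ n) = f (t, snd p0 + y)"
    using infsum_Sigma'_banach[OF sm] infsumI[OF S] by simp
  ultimately have "((\<lambda>m. \<Sum>\<^sub>\<infinity>n. c m n * ?x ^ m * y ^ n) has_sum f (t, snd p0 + y)) UNIV"
    by (simp add: has_sum_iff)
  moreover have "(\<Sum>\<^sub>\<infinity>n. c m n * ?x ^ m * y ^ n) = (\<Sum>\<^sub>\<infinity>n. c m n * y ^ n) * ?x ^ m" for m
    by (subst infsum_cmult_left'[symmetric]) (simp add: mult_ac)
  ultimately show ?thesis
    by (simp add: has_sum_imp_sums)
qed

lemma double_power_series_column_summable:
  assumes dps: "double_power_series c r f p0" and y: "\<bar>y\<bar> < r"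
  shows "(\<lambda>n. c m n * y ^ n) summable_on UNIV"
proof -
  have r: "r > 0" using dps by (simp add: double_power_series_def)
  have "((\<lambda>(m, n). c m n * (r/2) ^ m * y ^ n) has_sum f (fst p0 + r/2, snd p0 + y)) UNIV"
    using dps y r by (simp add: double_power_series_def)
  then have "(\<lambda>(m, n). c m n * (r/2) ^ m * y ^ n) summable_on Sigma UNIV (\<lambda>_. UNIV)"
    using has_sum_imp_summable by simp
  then have "(\<lambda>n. c m n * (r/2) ^ m * y ^ n) summable_on UNIV"
    by (rule summable_on_SigmaD1) simp
  then have "(\<lambda>n. (r/2) ^ m * (c m n * y ^ n)) summable_on UNIV"
    by (simp add: mult_ac)
  then show ?thesis
    using r by (subst (asm) summable_on_cmult_right') auto
qed

lemma infsum_power_0: "(\<Sum>\<^sub>\<infinity>n. b n * 0 ^ n) = (b 0 :: real)"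
proof -
  have "((\<lambda>n. b n * 0 ^ n) has_sum b 0) UNIV"
    by (rule has_sum_finite_neutralI[of "{0}"]) auto
  then show ?thesis by (rule infsumI)
qed

lemma double_power_series_deriv11:
  assumes dps: "double_power_series c r f p0"
  shows "partial1 (partial1 f) p0 = 2 * c 2 0"
proof -
  have r: "r > 0" using dps by (simp add: double_power_series_def)
  have "(\<lambda>m. c m 0 * (t - fst p0) ^ m) sums f (t, snd p0)" if "\<bar>t - fst p0\<bar> < r" for t
    using double_power_series_row[OF dps _ that, of 0] r by (simp add: infsum_power_0)
  then have "(\<lambda>m. diffs (\<lambda>m. c m 0) m * (t - fst p0) ^ m) sums deriv (\<lambda>t. f (t, snd p0)) t"
    if "\<bar>t - fst p0\<bar> < r" for t
    by (rule power_series_deriv) (use that in auto)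
  then have "deriv (deriv (\<lambda>t. f (t, snd p0))) (fst p0) = diffs (\<lambda>m. c m 0) 1"
    by (rule power_series_deriv_centre) (use r in auto)
  then show ?thesis
    by (simp add: partial1_def[abs_def] diffs_def numeral_2_eq_2)
qed

text \<open>The first partial derivative on the line through the centre is the first
  coefficient of the row expansion, which is itself a power series in the second variable.\<close>

lemma double_power_series_deriv21:
  assumes dps: "double_power_series c r f p0"
  shows "partial2 (partial1 f) p0 = c 1 1"
proof -
  have r: "r > 0" using dps by (simp add: double_power_series_def)
  have p1: "deriv (\<lambda>t. f (t, s)) (fst p0) = (\<Sum>\<^sub>\<infinity>n. c 1 n * (s - snd p0) ^ n)"
    if s: "\<bar>s - snd p0\<bar> < r" for s
    by (rule power_series_deriv_centre[where r = r])
      (use double_power_series_row[OF dps s] r in auto)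
  have "(\<lambda>n. c 1 n * (s - snd p0) ^ n) sums deriv (\<lambda>t. f (t, s)) (fst p0)"
    if s: "\<bar>s - snd p0\<bar> < r" for s
    unfolding p1[OF s]
    by (rule has_sum_imp_sums, rule has_sum_infsum, rule double_power_series_column_summable[OF dps s])
  then have "deriv (\<lambda>s. deriv (\<lambda>t. f (t, s)) (fst p0)) (snd p0) = c 1 1"
    by (rule power_series_deriv_centre) (use r in auto)
  then show ?thesis
    by (simp add: partial1_def[abs_def] partial2_def)
qed

text \<open>The entries of the Hessian are iterated \<open>deriv\<close> values, so they must be computed from
  the series. The two entries in which the second variable is differentiated first follow by
  swapping the variables.\<close>

lemma double_power_series_hessian:
  assumes dps: "double_power_series c r f p0"
  shows "hessian f p0 = vector [vector [2 * c 2 0, c 1 1], vector [c 1 1, 2 * c 0 2]]"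
proof -
  let ?g = "\<lambda>p. f (snd p, fst p)" and ?q = "(snd p0, fst p0)"
  note dps' = double_power_series_swap[OF dps]
  have "partial2 (partial2 f) p0 = partial1 (partial1 ?g) ?q"
    and "partial1 (partial2 f) p0 = partial2 (partial1 ?g) ?q"
    by (simp_all add: partial1_def[abs_def] partial2_def[abs_def])
  then have "partial2 (partial2 f) p0 = 2 * c 0 2" "partial1 (partial2 f) p0 = c 1 1"
    using double_power_series_deriv11[OF dps'] double_power_series_deriv21[OF dps'] by auto
  then show ?thesis
    by (simp add: hessian_def double_power_series_deriv11[OF dps] double_power_series_deriv21[OF dps])
qed

text \<open>A term of total degree at least three, at a point with coordinates bounded by \<open>s\<close>, is at most
  \<open>(s / \<rho>)\<^sup>3\<close> times its absolute value at \<open>(\<rho>, \<rho>)\<close>; the sum of the latter values is finite.\<close>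

lemma double_power_series_taylor2:
  assumes dps: "double_power_series c r f p0"
  obtains K \<rho> where "\<rho> > 0" "K \<ge> 0"
    "\<And>x y s. \<bar>x\<bar> \<le> s \<Longrightarrow> \<bar>y\<bar> \<le> s \<Longrightarrow> s \<le> \<rho> \<Longrightarrow>
       \<bar>f (fst p0 + x, snd p0 + y) - (c 0 0 + c 1 0 * x + c 0 1 * y
          + (c 2 0 * x\<^sup>2 + c 1 1 * x * y + c 0 2 * y\<^sup>2))\<bar> \<le> K * s ^ 3"
proof -
  have r: "r > 0" using dps by (simp add: double_power_series_def)
  define \<rho> where "\<rho> = r / 2"
  have \<rho>: "\<rho> > 0" "\<rho> < r" using r by (auto simp: \<rho>_def)
  define S :: "(nat \<times> nat) set" where "S = {(0, 0), (1, 0), (0, 1), (2, 0), (1, 1), (0, 2)}"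
  have "finite S" by (simp add: S_def)
  let ?a = "\<lambda>(m, n). \<bar>c m n\<bar> * \<rho> ^ (m + n)"
  have "(\<lambda>(m, n). c m n * \<rho> ^ m * \<rho> ^ n) summable_on UNIV"
    using dps \<rho> unfolding double_power_series_def
    by (intro has_sum_imp_summable[of _ _ "f (fst p0 + \<rho>, snd p0 + \<rho>)"]) auto
  then have "(\<lambda>x. norm (case x of (m, n) \<Rightarrow> c m n * \<rho> ^ m * \<rho> ^ n)) summable_on UNIV"
    by (rule summable_on_iff_abs_summable_on_real[THEN iffD1])
  also have "(\<lambda>x. norm (case x of (m, n) \<Rightarrow> c m n * \<rho> ^ m * \<rho> ^ n)) = ?a"
    using \<rho> by (auto simp: fun_eq_iff abs_mult power_add)
  finally have "?a summable_on UNIV" .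
  then have aS: "?a summable_on (UNIV - S)"
    by (rule summable_on_subset) auto
  define A where "A = infsum ?a (UNIV - S)"
  have hA: "(?a has_sum A) (UNIV - S)"
    unfolding A_def using aS by (rule has_sum_infsum)
  have "A \<ge> 0"
    by (rule has_sum_nonneg[OF hA]) (use \<rho> in auto)
  show thesis
  proof (rule that[of \<rho> "A / \<rho> ^ 3"])
    fix x y s :: real
    assume xs: "\<bar>x\<bar> \<le> s" and ys: "\<bar>y\<bar> \<le> s" and s: "s \<le> \<rho>"
    let ?t = "\<lambda>(m, n). c m n * x ^ m * y ^ n"
    have "\<bar>x\<bar> < r" "\<bar>y\<bar> < r" using xs ys s \<rho> by auto
    then have "(?t has_sum f (fst p0 + x, snd p0 + y)) UNIV"
      using dps by (simp add: double_power_series_def)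
    moreover have "(?t has_sum sum ?t S) S"
      using \<open>finite S\<close> by simp
    ultimately have h: "(?t has_sum f (fst p0 + x, snd p0 + y) - sum ?t S) (UNIV - S)"
      by (rule has_sum_Diff) simp
    have s0: "s \<ge> 0" using xs by linarith
    have bd: "norm (?t mn) \<le> ?a mn * (s / \<rho>) ^ 3" if mn: "mn \<in> UNIV - S" for mn
    proof -
      obtain m n where [simp]: "mn = (m, n)" by (cases mn)
      have "m + n \<ge> 3"
      proof (rule ccontr)
        assume "\<not> m + n \<ge> 3"
        then have "m \<in> {0, 1, 2} \<and> n \<in> {0, 1, 2} \<and> m + n < 3" by auto
        then have "(m, n) \<in> S" unfolding S_def by auto
        with mn show False by simp
      qed
      then obtain k where k: "m + n = k + 3" using le_Suc_ex by (metis add.commute)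
      have "norm (?t mn) = \<bar>c m n\<bar> * (\<bar>x\<bar> ^ m * \<bar>y\<bar> ^ n)"
        by (simp add: abs_mult power_abs)
      also have "\<bar>x\<bar> ^ m * \<bar>y\<bar> ^ n \<le> s ^ m * s ^ n"
        using xs ys s0 by (intro mult_mono power_mono) auto
      also have "s ^ m * s ^ n = s ^ k * s ^ 3"
        by (metis k power_add)
      also have "\<dots> \<le> \<rho> ^ k * s ^ 3"
        using s s0 by (intro mult_right_mono power_mono) auto
      also have "\<dots> = \<rho> ^ (m + n) * (s / \<rho>) ^ 3"
        using \<rho> k by (simp add: power_add power_divide)
      finally show ?thesis by (simp add: mult.assoc mult_left_mono)
    qed
    have "norm (f (fst p0 + x, snd p0 + y) - sum ?t S) \<le> A * (s / \<rho>) ^ 3"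
      by (rule norm_infsum_le[OF h has_sum_cmult_left[OF hA] bd])
    moreover have "sum ?t S = c 0 0 + c 1 0 * x + c 0 1 * y
          + (c 2 0 * x\<^sup>2 + c 1 1 * x * y + c 0 2 * y\<^sup>2)"
      by (simp add: S_def)
    ultimately show "\<bar>f (fst p0 + x, snd p0 + y) - (c 0 0 + c 1 0 * x + c 0 1 * y
          + (c 2 0 * x\<^sup>2 + c 1 1 * x * y + c 0 2 * y\<^sup>2))\<bar> \<le> A / \<rho> ^ 3 * s ^ 3"
      by (simp add: power_divide)
  qed (use \<rho> \<open>A \<ge> 0\<close> in auto)
qed

section \<open>The gap below the maximum\<close>

text \<open>A crude form of Jordan's inequality, read off from \<open>sin u \<ge> u - u\<^sup>3 / 6\<close> and
  \<open>u \<le> 2\<close>.\<close>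

lemma sin_ge_third:
  fixes u :: real
  assumes "0 \<le> u" "u \<le> pi / 2"
  shows "u / 3 \<le> sin u"
proof -
  have "u \<le> 2" using assms pi_less_4 by linarith
  have "sin u \<ge> u - u ^ 3 / 6"
    using Maclaurin_sin_bound[of u 3] assms
    by (simp add: sin_coeff_def numeral_3_eq_3 fact_numeral abs_if split: if_splits)
  moreover have "u ^ 3 \<le> 4 * u"
  proof -
    have "u * u \<le> 2 * 2" using \<open>u \<le> 2\<close> assms by (intro mult_mono) auto
    then have "u * (u * u) \<le> u * 4" using assms by (intro mult_left_mono) auto
    then show ?thesis by (simp add: power3_eq_cube)
  qed
  ultimately show ?thesis by linarith
qed

lemma one_minus_cos: "1 - cos (u::real) = 2 * (sin (u / 2))\<^sup>2"
  using cos_double_sin[of "u / 2"] by simp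

lemma one_minus_cos_le: "1 - cos (u::real) \<le> u\<^sup>2 / 2"
proof -
  have "\<bar>sin (u / 2)\<bar> \<le> \<bar>u / 2\<bar>" by (rule abs_sin_x_le_abs_x)
  then have "(sin (u / 2))\<^sup>2 \<le> (u / 2)\<^sup>2" by (simp only: abs_le_square_iff)
  then show ?thesis by (simp add: one_minus_cos power_divide)
qed

lemma one_minus_cos_ge:
  fixes u :: real
  assumes "\<bar>u\<bar> \<le> pi"
  shows "u\<^sup>2 / 18 \<le> 1 - cos u"
proof -
  have "\<bar>u\<bar> / 6 \<le> sin (\<bar>u\<bar> / 2)" using sin_ge_third[of "\<bar>u\<bar> / 2"] assms by simp
  then have "(\<bar>u\<bar> / 6)\<^sup>2 \<le> (sin (\<bar>u\<bar> / 2))\<^sup>2" by (intro power_mono) auto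
  then have "u\<^sup>2 / 18 \<le> 1 - cos \<bar>u\<bar>" unfolding one_minus_cos by (simp add: power_divide)
  then show ?thesis by simp
qed

lemma emax_eq:
  assumes "\<And>p. p \<in> T2 \<Longrightarrow> p \<noteq> (pi, pi) \<Longrightarrow> e p < e (pi, pi)"
  shows "emax e = e (pi, pi)"
  unfolding emax_def
proof (rule cSup_eq_maximum)
  have "(pi, pi) \<in> T2" using pi_gt_zero by (simp add: T2_def del: pi_gt_zero)
  then show "e (pi, pi) \<in> e ` T2" by blast
next
  fix y assume "y \<in> e ` T2"
  then show "y \<le> e (pi, pi)" using assms by (metis imageE less_eq_real_def)
qed

text \<open>By homogeneity \<open>\<kappa>\<close> can be taken as minus the maximum of the form on the unit circle.\<close>

lemma negative_quadratic_form_bound: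
  fixes \<alpha> \<beta> \<gamma> :: real
  defines "Q \<equiv> \<lambda>x y. \<alpha> * x\<^sup>2 + \<beta> * x * y + \<gamma> * y\<^sup>2"
  assumes neg: "\<And>x y. (x, y) \<noteq> (0, 0) \<Longrightarrow> Q x y < 0"
  shows "\<exists>\<kappa>>0. \<forall>x y. Q x y \<le> - \<kappa> * (x\<^sup>2 + y\<^sup>2)"
proof -
  let ?S = "sphere (0 :: real \<times> real) 1"
  have cont: "continuous_on ?S (\<lambda>p. Q (fst p) (snd p))"
    unfolding Q_def by (intro continuous_intros)
  have "(1, 0) \<in> ?S" by simp
  then have "?S \<noteq> {}" by blast
  then obtain q where q: "q \<in> ?S" and max: "\<And>p. p \<in> ?S \<Longrightarrow> Q (fst p) (snd p) \<le> Q (fst q) (snd q)"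
    using continuous_attains_sup[OF compact_sphere _ cont] by blast
  define \<kappa> where "\<kappa> = - Q (fst q) (snd q)"
  have "q \<noteq> 0" using q by auto
  then have "\<kappa> > 0" using neg[of "fst q" "snd q"] by (auto simp: \<kappa>_def zero_prod_def)
  moreover have "Q x y \<le> - \<kappa> * (x\<^sup>2 + y\<^sup>2)" for x y
  proof (cases "(x, y) = (0, 0)")
    case True
    then show ?thesis by (simp add: Q_def)
  next
    case False
    define n where "n = norm (x, y)"
    have n: "n > 0" "n\<^sup>2 = x\<^sup>2 + y\<^sup>2" using False by (auto simp: n_def norm_Pair sum_power2_gt_zero_iff)
    have "norm (x / n, y / n) = 1"
      using n False by (simp add: norm_Pair power_divide flip: add_divide_distrib)
    then have "Q (x / n) (y / n) \<le> - \<kappa>"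
      using max[of "(x / n, y / n)"] by (simp add: \<kappa>_def)
    moreover have "Q (x / n) (y / n) = Q x y / n\<^sup>2"
      by (simp add: Q_def power_divide power2_eq_square add_divide_distrib)
    ultimately have "Q x y \<le> - \<kappa> * n\<^sup>2"
      using n(1) by (simp only: pos_divide_le_eq zero_less_power)
    then show ?thesis by (simp add: n)
  qed
  ultimately show ?thesis by blast
qed

lemma dispersion_reflect_at_pi:
  assumes disp: "is_dispersion ehat e" and even: "\<And>p. e (- p) = e p"
  shows "e (pi + x, pi + y) = e (pi - x, pi - y)"
proof -
  have "e (pi + x, pi + y) = e (- (pi + x), - (pi + y))"
    using even[of "(pi + x, pi + y)"] by simp
  also have "\<dots> = e (- (pi + x) + 2 * pi * of_int 1, - (pi + y) + 2 * pi * of_int 1)"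
    by (simp only: dispersion_periodic[OF disp])
  also have "\<dots> = e (pi - x, pi - y)"
    by simp
  finally show ?thesis .
qed

text \<open>Since \<open>e (pi + x, pi + y)\<close> is unchanged when \<open>(x, y)\<close> changes sign, averaging the second-order
  expansion over the two signs removes the linear terms. What remains is minus half the Hessian form, which is
  comparable to \<open>x\<^sup>2 + y\<^sup>2\<close>, and a cubic error that it absorbs near the maximum.\<close>

lemma gap_quadratic_near_pi:
  assumes disp: "is_dispersion ehat e"
    and even: "\<And>p. e (- p) = e p"
    and nondegenerate: "negative_definite (hessian e (pi, pi))"
    and analytic: "real_analytic_near e (pi, pi)"
  obtains c C \<delta> where "c > 0" "C > 0" "\<delta> > 0"
    "\<And>x y. norm (x, y) \<le> \<delta> \<Longrightarrow> c * (x\<^sup>2 + y\<^sup>2) \<le> e (pi, pi) - e (pi + x, pi + y)"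
    "\<And>x y. norm (x, y) \<le> \<delta> \<Longrightarrow> e (pi, pi) - e (pi + x, pi + y) \<le> C * (x\<^sup>2 + y\<^sup>2)"
proof -
  have "real_analytic_at e (pi, pi)"
    using analytic by (auto simp: real_analytic_near_def)
  then obtain a r where dps: "double_power_series a r e (pi, pi)"
    by (rule real_analytic_at_imp_double_power_series)
  define Q where "Q = (\<lambda>x y. a 2 0 * x\<^sup>2 + a 1 1 * x * y + a 0 2 * y\<^sup>2)"
  obtain K \<rho> where \<rho>: "\<rho> > 0" and K: "K \<ge> 0"
    and T0: "\<And>x y s. \<bar>x\<bar> \<le> s \<Longrightarrow> \<bar>y\<bar> \<le> s \<Longrightarrow> s \<le> \<rho> \<Longrightarrow>
       \<bar>e (fst (pi, pi) + x, snd (pi, pi) + y) - (a 0 0 + a 1 0 * x + a 0 1 * y + Q x y)\<bar> \<le> K * s ^ 3"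
    unfolding Q_def by (rule double_power_series_taylor2[OF dps]) blast
  have "a 0 0 = e (pi, pi)"
    using T0[of 0 0 0] \<rho> by (simp add: Q_def)
  have Q_approx: "\<bar>e (pi, pi) - e (pi + x, pi + y) + Q x y\<bar> \<le> K * s ^ 3"
    if "\<bar>x\<bar> \<le> s" "\<bar>y\<bar> \<le> s" "s \<le> \<rho>" for x y s
  proof -
    have "e (pi + - x, pi + - y) = e (pi + x, pi + y)"
      using dispersion_reflect_at_pi[OF disp even, where x = x and y = y] by simp
    moreover have "Q (- x) (- y) = Q x y" by (simp add: Q_def)
    ultimately show ?thesis
      using T0[of x s y] T0[of "- x" s "- y"] that \<open>a 0 0 = e (pi, pi)\<close> by (simp add: abs_le_iff)
  qed
  have neg: "Q x y < 0" if "(x, y) \<noteq> (0, 0)" for x y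
  proof -
    let ?v = "vector [x, y] :: real ^ 2"
    have "?v \<noteq> 0" using that by (auto simp: vec_eq_iff forall_2)
    then have "?v \<bullet> (hessian e (pi, pi) *v ?v) < 0"
      using nondegenerate by (simp add: negative_definite_def)
    also have "?v \<bullet> (hessian e (pi, pi) *v ?v) = 2 * Q x y"
      by (simp add: double_power_series_hessian[OF dps] inner_vec_def sum_2 matrix_vector_mult_def
          Q_def power2_eq_square algebra_simps)
    finally show ?thesis by simp
  qed
  have "\<exists>\<kappa>>0. \<forall>x y. Q x y \<le> - \<kappa> * (x\<^sup>2 + y\<^sup>2)"
    using neg unfolding Q_def by (rule negative_quadratic_form_bound)
  then obtain \<kappa> where \<kappa>: "\<kappa> > 0" and Q\<kappa>: "\<And>x y. Q x y \<le> - \<kappa> * (x\<^sup>2 + y\<^sup>2)"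
    by blast
  define M where "M = \<bar>a 2 0\<bar> + \<bar>a 1 1\<bar> + \<bar>a 0 2\<bar>"
  have QM: "- Q x y \<le> M * (x\<^sup>2 + y\<^sup>2)" for x y
  proof -
    have xy: "\<bar>x * y\<bar> \<le> x\<^sup>2 + y\<^sup>2"
    proof -
      have "2 * (\<bar>x\<bar> * \<bar>y\<bar>) \<le> x\<^sup>2 + y\<^sup>2"
        using sum_squares_bound[of "\<bar>x\<bar>" "\<bar>y\<bar>"] by simp
      moreover have "0 \<le> \<bar>x\<bar> * \<bar>y\<bar>" by simp
      ultimately show ?thesis unfolding abs_mult by linarith
    qed
    have "- Q x y = - a 2 0 * x\<^sup>2 + - a 1 1 * (x * y) + - a 0 2 * y\<^sup>2" by (simp add: Q_def)
    also have "\<dots> \<le> \<bar>a 2 0\<bar> * (x\<^sup>2 + y\<^sup>2) + \<bar>a 1 1\<bar> * (x\<^sup>2 + y\<^sup>2) + \<bar>a 0 2\<bar> * (x\<^sup>2 + y\<^sup>2)"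
    proof (intro add_mono)
      show "- a 2 0 * x\<^sup>2 \<le> \<bar>a 2 0\<bar> * (x\<^sup>2 + y\<^sup>2)" "- a 0 2 * y\<^sup>2 \<le> \<bar>a 0 2\<bar> * (x\<^sup>2 + y\<^sup>2)"
        by (intro mult_mono; simp)+
      have "- a 1 1 * (x * y) \<le> \<bar>a 1 1 * (x * y)\<bar>" by (simp add: abs_ge_minus_self)
      also have "\<dots> \<le> \<bar>a 1 1\<bar> * (x\<^sup>2 + y\<^sup>2)" unfolding abs_mult[of "a 1 1"] using xy by (intro mult_left_mono) auto
      finally show "- a 1 1 * (x * y) \<le> \<bar>a 1 1\<bar> * (x\<^sup>2 + y\<^sup>2)" .
    qed
    finally show ?thesis by (simp add: M_def algebra_simps)
  qed
  \<comment> \<open>Small enough for the cubic error to take away at most half of the quadratic term.\<close>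
  define \<delta> where "\<delta> = min \<rho> (\<kappa> / (2 * (K + 1)))"
  have \<delta>: "\<delta> > 0" "\<delta> \<le> \<rho>" "K * \<delta> \<le> \<kappa> / 2"
  proof -
    show "\<delta> > 0" "\<delta> \<le> \<rho>" using \<rho> \<kappa> K by (auto simp: \<delta>_def)
    have "(K + 1) * \<delta> \<le> (K + 1) * (\<kappa> / (2 * (K + 1)))"
      using K by (intro mult_left_mono) (auto simp: \<delta>_def)
    also have "\<dots> = \<kappa> / 2" using K by (simp add: field_simps)
    finally show "K * \<delta> \<le> \<kappa> / 2" using \<open>\<delta> > 0\<close> by (simp add: algebra_simps)
  qed
  have err: "\<bar>e (pi, pi) - e (pi + x, pi + y) + Q x y\<bar> \<le> \<kappa> / 2 * (x\<^sup>2 + y\<^sup>2)"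
    if n: "norm (x, y) \<le> \<delta>" for x y
  proof -
    let ?s = "norm (x, y)"
    have "\<bar>x\<bar> \<le> ?s" "\<bar>y\<bar> \<le> ?s" using norm_fst_le[of x y] norm_snd_le[of y x] by auto
    then have "\<bar>e (pi, pi) - e (pi + x, pi + y) + Q x y\<bar> \<le> K * ?s ^ 3"
      using n \<delta> by (intro Q_approx) auto
    also have "K * ?s ^ 3 = (K * ?s) * ?s\<^sup>2" by (simp add: power3_eq_cube power2_eq_square)
    also have "\<dots> \<le> \<kappa> / 2 * ?s\<^sup>2"
    proof (rule mult_right_mono)
      have "K * ?s \<le> K * \<delta>" using n K by (intro mult_left_mono)
      then show "K * ?s \<le> \<kappa> / 2" using \<delta> by linarith
    qed simp
    also have "?s\<^sup>2 = x\<^sup>2 + y\<^sup>2" by (simp add: norm_Pair)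
    finally show ?thesis .
  qed
  show thesis
  proof (rule that[of "\<kappa> / 2" "M + \<kappa> / 2" \<delta>])
    show "\<kappa> / 2 > 0" "M + \<kappa> / 2 > 0" using \<kappa> by (auto simp: M_def add_nonneg_pos)
    fix x y :: real assume n: "norm (x, y) \<le> \<delta>"
    show "\<kappa> / 2 * (x\<^sup>2 + y\<^sup>2) \<le> e (pi, pi) - e (pi + x, pi + y)"
      using err[OF n] Q\<kappa>[of x y] by (simp add: abs_le_iff algebra_simps)
    show "e (pi, pi) - e (pi + x, pi + y) \<le> (M + \<kappa> / 2) * (x\<^sup>2 + y\<^sup>2)"
      using err[OF n] QM[of x y] unfolding abs_le_iff by (simp add: algebra_simps)
  qed (rule \<delta>)
qed

text \<open>The square \<open>[0, 2 pi]\<^sup>2\<close> is a compact fundamental domain (up to its edges) that has the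
  maximum point in its interior.\<close>

lemma dispersion_less_max:
  assumes disp: "is_dispersion ehat e"
    and unique_max: "\<And>p. p \<in> T2 \<Longrightarrow> p \<noteq> (pi, pi) \<Longrightarrow> e p < e (pi, pi)"
    and q: "q \<in> cbox (0, 0) (2 * pi, 2 * pi)" "q \<noteq> (pi, pi)"
  shows "e q < e (pi, pi)"
proof -
  obtain x y where [simp]: "q = (x, y)" by (cases q)
  have xy: "0 \<le> x" "x \<le> 2 * pi" "0 \<le> y" "y \<le> 2 * pi" using q by (auto simp: cbox_Pair_eq)
  define k l :: int where "k = (if x \<le> pi then 0 else - 1)" and "l = (if y \<le> pi then 0 else - 1)"
  let ?p = "(x + 2 * pi * of_int k, y + 2 * pi * of_int l)"
  have "?p \<in> T2" using xy pi_gt_zero by (auto simp: T2_def k_def l_def simp del: pi_gt_zero)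
  moreover have "?p \<noteq> (pi, pi)" using q xy pi_gt_zero by (auto simp: k_def l_def simp del: pi_gt_zero)
  ultimately show ?thesis
    using unique_max[of ?p] dispersion_periodic[OF disp, of x k y l] by simp
qed

text \<open>The explicit function \<open>profile ES\<close>, which is \<open>(1 + cos p1) + (1 + cos p2)\<close>, vanishes
  quadratically at \<open>(pi, pi)\<close>, and only there on \<open>T2\<close>, just as the gap does. Hence the quotient of the two is bounded
  above and below: near the maximum by the quadratic estimates, elsewhere by compactness. All
  integrability questions about the gap thereby become questions about cosines.\<close>

lemma gap_comparison:
  assumes disp: "is_dispersion ehat e"
    and even: "\<And>p. e (- p) = e p"
    and unique_max: "\<And>p. p \<in> T2 \<Longrightarrow> p \<noteq> (pi, pi) \<Longrightarrow> e p < e (pi, pi)"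
    and nondegenerate: "negative_definite (hessian e (pi, pi))"
    and analytic: "real_analytic_near e (pi, pi)"
  obtains c C where "c > 0" "C > 0"
    "\<And>p. p \<in> T2 \<Longrightarrow> c * profile ES p \<le> emax e - e p"
    "\<And>p. p \<in> T2 \<Longrightarrow> emax e - e p \<le> C * profile ES p"
proof -
  let ?D = "\<lambda>p. e (pi, pi) - e p" and ?w = "profile ES"
  obtain c0 C0 \<delta>0 where c0: "c0 > 0" "C0 > 0" "\<delta>0 > 0"
    and lo0: "\<And>x y. norm (x, y) \<le> \<delta>0 \<Longrightarrow> c0 * (x\<^sup>2 + y\<^sup>2) \<le> ?D (pi + x, pi + y)"
    and hi0: "\<And>x y. norm (x, y) \<le> \<delta>0 \<Longrightarrow> ?D (pi + x, pi + y) \<le> C0 * (x\<^sup>2 + y\<^sup>2)"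
    using gap_quadratic_near_pi[OF disp even nondegenerate analytic] by blast
  define \<delta> where "\<delta> = min \<delta>0 pi"
  have \<delta>: "\<delta> > 0" "\<delta> \<le> \<delta>0" "\<delta> \<le> pi" using c0 by (auto simp: \<delta>_def)
  have w_le: "?w (pi + x, pi + y) \<le> (x\<^sup>2 + y\<^sup>2) / 2" for x y
    using one_minus_cos_le[of x] one_minus_cos_le[of y] by (simp add: cos_add add_divide_distrib)
  have w_ge: "(x\<^sup>2 + y\<^sup>2) / 18 \<le> ?w (pi + x, pi + y)" if "\<bar>x\<bar> \<le> pi" "\<bar>y\<bar> \<le> pi" for x y
    using one_minus_cos_ge[of x] one_minus_cos_ge[of y] that by (simp add: cos_add add_divide_distrib)
  let ?B = "cbox (0, 0) (2 * pi, 2 * pi)" and ?K = "cbox (0, 0) (2 * pi, 2 * pi) - ball (pi, pi) \<delta>"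
  have w_pos: "?w q > 0" if "q \<in> ?B" "q \<noteq> (pi, pi)" for q
  proof -
    obtain x y where q: "q = (pi + x, pi + y)"
      by (rule that[of "fst q - pi" "snd q - pi"]) simp
    have "\<bar>x\<bar> \<le> pi" "\<bar>y\<bar> \<le> pi" using that(1) by (auto simp: q cbox_Pair_eq)
    moreover have "x\<^sup>2 + y\<^sup>2 > 0" using that(2) by (simp add: q sum_power2_gt_zero_iff)
    ultimately show ?thesis using w_ge[of x y] by (simp add: q)
  qed
  have K: "compact ?K" by (intro compact_diff compact_cbox open_ball)
  have "(0, 0) \<in> ?K"
  proof -
    have "pi \<le> dist (pi, pi) (0, 0)"
      using norm_fst_le[of pi pi] by (simp add: dist_norm zero_prod_def[symmetric])
    then show ?thesis using \<delta> by (auto simp: cbox_Pair_eq)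
  qed
  then have Kne: "?K \<noteq> {}" by blast
  have K_pos: "?w q > 0" "?D q > 0" if "q \<in> ?K" for q
  proof -
    have "q \<noteq> (pi, pi)" using that \<delta>(1) by fastforce
    then show "?w q > 0" "?D q > 0"
      using that w_pos[of q] dispersion_less_max[OF disp unique_max, of q] by auto
  qed
  have "continuous_on ?K ?D"
    by (intro continuous_intros continuous_on_subset[OF dispersion_continuous[OF disp]]) auto
  moreover have "continuous_on ?K ?w"
    by (subst profile.simps[abs_def]) (intro continuous_intros)
  ultimately have cont: "continuous_on ?K (\<lambda>q. ?D q / ?w q)"
    using K_pos by (intro continuous_on_divide) force+
  obtain u where u: "u \<in> ?K" "\<And>q. q \<in> ?K \<Longrightarrow> ?D u / ?w u \<le> ?D q / ?w q"
    using continuous_attains_inf[OF K Kne cont] by blast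
  obtain v where v: "v \<in> ?K" "\<And>q. q \<in> ?K \<Longrightarrow> ?D q / ?w q \<le> ?D v / ?w v"
    using continuous_attains_sup[OF K Kne cont] by blast
  define c where "c = min (2 * c0) (?D u / ?w u)"
  define C where "C = max (18 * C0) (?D v / ?w v)"
  have cC: "c > 0" "C > 0" using c0 K_pos[OF u(1)] by (auto simp: c_def C_def less_max_iff_disj)
  have main: "c * ?w q \<le> ?D q \<and> ?D q \<le> C * ?w q" if q: "q \<in> ?B" for q
  proof (cases "q \<in> ball (pi, pi) \<delta>")
    case True
    obtain x y where qxy: "q = (pi + x, pi + y)"
      by (rule that[of "fst q - pi" "snd q - pi"]) simp
    have "\<bar>x\<bar> \<le> pi" "\<bar>y\<bar> \<le> pi" using q by (auto simp: qxy cbox_Pair_eq)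
    then have w2: "(x\<^sup>2 + y\<^sup>2) / 18 \<le> ?w q" "?w q \<le> (x\<^sup>2 + y\<^sup>2) / 2"
      unfolding qxy using w_ge[of x y] w_le[of x y] by auto
    have w0: "0 \<le> ?w q" using w2(1) by (smt (verit) sum_power2_ge_zero divide_nonneg_pos)
    have "norm (x, y) < \<delta>" using True by (simp add: qxy dist_norm norm_Pair)
    then have n: "norm (x, y) \<le> \<delta>0" using \<delta> by simp
    have "c * ?w q \<le> (2 * c0) * ?w q" using w0 by (intro mult_right_mono) (auto simp: c_def)
    also have "\<dots> \<le> (2 * c0) * ((x\<^sup>2 + y\<^sup>2) / 2)" using w2 c0 by (intro mult_left_mono) auto
    also have "\<dots> \<le> ?D q" using lo0[OF n] by (simp add: qxy)
    finally have 1: "c * ?w q \<le> ?D q" .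
    have "?D q \<le> (18 * C0) * ((x\<^sup>2 + y\<^sup>2) / 18)" using hi0[OF n] by (simp add: qxy)
    also have "\<dots> \<le> (18 * C0) * ?w q" using w2 c0 by (intro mult_left_mono) auto
    also have "\<dots> \<le> C * ?w q" using w0 by (intro mult_right_mono) (auto simp: C_def)
    finally show ?thesis using 1 by simp
  next
    case False
    then have qK: "q \<in> ?K" using q by blast
    have "c \<le> ?D q / ?w q" "?D q / ?w q \<le> C"
      using u(2)[OF qK] v(2)[OF qK] by (auto simp: c_def C_def)
    then show ?thesis using K_pos[OF qK] by (simp only: pos_le_divide_eq pos_divide_le_eq)
  qed
  have all: "c * ?w p \<le> emax e - e p \<and> emax e - e p \<le> C * ?w p" if p: "p \<in> T2" for p
  proof -
    obtain x y where [simp]: "p = (x, y)" by (cases p)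
    define k l :: int where "k = (if x < 0 then 1 else 0)" and "l = (if y < 0 then 1 else 0)"
    let ?q = "(x + 2 * pi * of_int k, y + 2 * pi * of_int l)"
    have "?q \<in> ?B" using p by (auto simp: T2_def k_def l_def cbox_Pair_eq)
    moreover have "e ?q = e p" using dispersion_periodic[OF disp, of x k y l] by simp
    moreover have "?w ?q = ?w p" by (auto simp: k_def l_def)
    ultimately show ?thesis using main[of ?q] emax_eq[of e, OF unique_max] by simp
  qed
  show thesis by (rule that[OF cC]) (use all in auto)
qed

section \<open>Integrals over the torus\<close>

lemma borel_measurable_torus: "f \<in> borel_measurable borel \<Longrightarrow> f \<in> borel_measurable torus"
  by (intro measurable_restrict_space1 measurable_completion) simp

lemma finite_measure_torus: "finite_measure torus"
proof (intro finite_measure_lebesgue_on bounded_set_imp_lmeasurable T2_lebesgue)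
  have "T2 \<subseteq> cbox (- pi, - pi) (pi, pi)" by (auto simp: T2_def cbox_Pair_eq)
  then show "bounded T2" using bounded_cbox bounded_subset by blast
qed

lemma space_torus [simp]: "space torus = T2"
  by (simp add: space_restrict_space)

lemma integrable_torus_bounded:
  fixes h :: "real \<times> real \<Rightarrow> 'a :: {banach, second_countable_topology}"
  assumes "h \<in> borel_measurable torus" and "\<And>p. p \<in> T2 \<Longrightarrow> norm (h p) \<le> B"
  shows "integrable torus h"
  using assms by (intro finite_measure.integrable_const_bound[OF finite_measure_torus, of _ B])
    (auto simp: AE_torus_iff)

lemma integrable_torus_mult_bounded:
  fixes f :: "real \<times> real \<Rightarrow> complex" and h :: "real \<times> real \<Rightarrow> real"
  assumes f: "integrable torus f" and h: "h \<in> borel_measurable borel" and B: "\<And>p. \<bar>h p\<bar> \<le> B"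
  shows "integrable torus (\<lambda>q. complex_of_real (h q) * f q)"
proof (rule Bochner_Integration.integrable_bound)
  show "integrable torus (\<lambda>q. B * norm (f q))" using f by simp
  have "(\<lambda>q. complex_of_real (h q)) \<in> borel_measurable torus"
    using h by (intro borel_measurable_torus) measurable
  then show "(\<lambda>q. complex_of_real (h q) * f q) \<in> borel_measurable torus"
    using f by measurable
  have "norm (complex_of_real (h q) * f q) \<le> norm (B * norm (f q))" for q
  proof -
    have "norm (complex_of_real (h q) * f q) = \<bar>h q\<bar> * norm (f q)" by (simp add: norm_mult)
    also have "\<dots> \<le> B * norm (f q)" using B by (intro mult_right_mono) auto
    also have "\<dots> \<le> norm (B * norm (f q))" by simp
    finally show ?thesis .
  qed
  then show "AE q in torus. norm (complex_of_real (h q) * f q) \<le> norm (B * norm (f q))" by simp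
qed

lemma not_AE_zero_torus:
  fixes h :: "real \<times> real \<Rightarrow> real"
  assumes cont: "continuous_on UNIV h"
    and p0: "\<bar>fst p0\<bar> < pi" "\<bar>snd p0\<bar> < pi" "h p0 \<noteq> 0"
  shows "\<not> (AE p in torus. h p = 0)"
proof
  assume "AE p in torus. h p = 0"
  then have ae: "AE p in lebesgue. p \<in> T2 \<longrightarrow> h p = 0" by (simp add: AE_torus_iff)
  let ?U = "box (- pi, - pi) (pi, pi) \<inter> h -` (- {0})"
  have "open ?U"
    by (intro open_Int open_box open_vimage cont) auto
  moreover have "p0 \<in> ?U" using p0 by (cases p0) (auto simp: box_def Basis_prod_def)
  moreover have "?U \<subseteq> T2 \<inter> h -` (- {0})" by (auto simp: box_def Basis_prod_def T2_def)
  then have "AE p in lebesgue. p \<notin> ?U"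
    using ae by (auto elim!: eventually_mono)
  then have "negligible ?U"
    unfolding negligible_iff_null_sets completion.null_sets_iff_AE by simp
  ultimately show False using open_not_negligible by blast
qed

lemma profile_eq:
  "profile OS = (\<lambda>q. sin (fst q) + sin (snd q))" "profile OA = (\<lambda>q. sin (fst q) - sin (snd q))"
  "profile EA = (\<lambda>q. cos (fst q) - cos (snd q))" "profile ES = (\<lambda>q. cos (fst q) + cos (snd q) + 2)"
  by (auto simp: fun_eq_iff)

lemma profile_continuous: "continuous_on UNIV (profile \<omega>)"
  by (cases \<omega>) (auto simp: profile_eq intro!: continuous_intros)

lemma profile_measurable [measurable]: "profile \<omega> \<in> borel_measurable borel"
  by (rule borel_measurable_continuous_onI[OF profile_continuous])

lemma profile_not_AE_zero: "\<not> (AE p in torus. profile \<omega> p = 0)"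
proof -
  let ?p0 = "case \<omega> of OS \<Rightarrow> (pi / 2, pi / 2) | OA \<Rightarrow> (pi / 2, - (pi / 2)) | EA \<Rightarrow> (0, pi / 2) | ES \<Rightarrow> (0, 0)"
  show ?thesis
    by (rule not_AE_zero_torus[OF profile_continuous, of ?p0]) (cases \<omega>; simp)+
qed

section \<open>The borderline singularities\<close>

text \<open>The primitive \<open>- 2 * sqrt (pi - t) + 2 * sqrt (pi + t)\<close> is continuous up to the end points.\<close>

lemma inverse_sqrt_integrable:
  "set_integrable lborel {- pi..pi} (\<lambda>t. 1 / sqrt (pi - t) + 1 / sqrt (pi + t))"
proof -
  let ?g = "\<lambda>t. 1 / sqrt (pi - t) + 1 / sqrt (pi + t)"
  have "(?g has_integral ((- 2 * sqrt (pi - pi) + 2 * sqrt (pi + pi))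
      - (- 2 * sqrt (pi - - pi) + 2 * sqrt (pi + - pi)))) {- pi..pi}"
  proof (rule fundamental_theorem_of_calculus_interior)
    fix t assume "t \<in> {- pi<..<pi}"
    then show "((\<lambda>t. - 2 * sqrt (pi - t) + 2 * sqrt (pi + t)) has_vector_derivative ?g t) (at t)"
      unfolding has_real_derivative_iff_has_vector_derivative[symmetric]
      by (auto intro!: derivative_eq_intros simp: field_simps)
  qed (auto intro!: continuous_intros)
  then have "?g absolutely_integrable_on {- pi..pi}"
    by (intro nonnegative_absolutely_integrable_1) auto
  then show ?thesis
    unfolding set_integrable_def by (subst (asm) integrable_completion) auto
qed

lemma integrable_product_lborel:
  fixes g :: "real \<Rightarrow> real"
  assumes "integrable lborel g"
  shows "integrable lborel (\<lambda>p. g (fst p) * g (snd p))"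
proof -
  have [measurable]: "g \<in> borel_measurable borel" using borel_measurable_integrable[OF assms] by simp
  have "integrable (lborel \<Otimes>\<^sub>M lborel) (\<lambda>p. g (fst p) * g (snd p))"
    by (rule lborel_pair.Fubini_integrable) (use assms in \<open>auto simp: abs_mult\<close>)
  then show ?thesis by (simp add: lborel_prod)
qed

lemma one_plus_cos_ge:
  fixes t :: real
  assumes "\<bar>t\<bar> \<le> pi"
  shows "(pi - \<bar>t\<bar>)\<^sup>2 / 18 \<le> 1 + cos t"
proof -
  have "cos (pi - \<bar>t\<bar>) = - cos t" by (simp add: cos_diff)
  then show ?thesis using one_minus_cos_ge[of "pi - \<bar>t\<bar>"] assms by simp
qed

text \<open>With \<open>u\<close> and \<open>v\<close> the distances of the coordinates from the edges, \<open>profile ES\<close> is at least a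
  multiple of \<open>u\<^sup>2 + v\<^sup>2\<close>, hence of \<open>u * v\<close>. So the function is dominated by a product of
  two integrable functions of one variable.\<close>

lemma inverse_sqrt_profile_ES_integrable:
  "integrable torus (\<lambda>p. 1 / sqrt (profile ES p))"
proof -
  let ?g = "\<lambda>t. indicator {- pi..pi} t * (1 / sqrt (pi - t) + 1 / sqrt (pi + t))"
  let ?w = "profile ES"
  have wm: "(\<lambda>p. 1 / sqrt (?w p)) \<in> borel_measurable torus"
    by (rule borel_measurable_torus) measurable
  have g: "integrable lborel ?g"
    using inverse_sqrt_integrable by (simp add: set_integrable_def)
  have "integrable lborel (\<lambda>p. 3 * (?g (fst p) * ?g (snd p)))"
    using integrable_product_lborel[OF g] by simp
  then have G: "integrable lebesgue (\<lambda>p. 3 * (?g (fst p) * ?g (snd p)))"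
    by (subst integrable_completion) auto
  have "integrable torus (\<lambda>p. 3 * (?g (fst p) * ?g (snd p)))"
    using integrable_mult_indicator[OF T2_lebesgue G] by (subst integrable_restrict_space) auto
  then show ?thesis
  proof (rule Bochner_Integration.integrable_bound[OF _ wm])
    show "AE p in torus. norm (1 / sqrt (?w p)) \<le> norm (3 * (?g (fst p) * ?g (snd p)))"
      using AE_torus_off_edges
    proof eventually_elim
      fix p :: "real \<times> real"
      assume p: "\<bar>fst p\<bar> < pi \<and> \<bar>snd p\<bar> < pi"
      define u v where "u = pi - \<bar>fst p\<bar>" and "v = pi - \<bar>snd p\<bar>"
      have uv: "u > 0" "v > 0" using p by (auto simp: u_def v_def)
      have "(1 / 3) * (1 / 3) * (u * v) \<le> (u\<^sup>2 + v\<^sup>2) / 18"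
        using sum_squares_bound[of u v] by simp
      also have "\<dots> \<le> ?w p"
        using one_plus_cos_ge[of "fst p"] one_plus_cos_ge[of "snd p"] p
        by (simp add: u_def v_def add_divide_distrib)
      finally have w: "(1 / 3) * (1 / 3) * (u * v) \<le> ?w p" .
      have "sqrt ((1 / 3) * (1 / 3) * (u * v)) \<le> sqrt (?w p)" using w by simp
      then have "(1 / 3) * (sqrt u * sqrt v) \<le> sqrt (?w p)" by (simp add: real_sqrt_mult real_sqrt_divide)
      moreover have "0 < (1 / 3) * (sqrt u * sqrt v)" using uv by simp
      ultimately have "1 / sqrt (?w p) \<le> 1 / ((1 / 3) * (sqrt u * sqrt v))"
        by (intro frac_le) auto
      also have "\<dots> = 3 * (1 / sqrt u * (1 / sqrt v))" by simp
      also have "\<dots> \<le> 3 * (?g (fst p) * ?g (snd p))"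
      proof (intro mult_left_mono mult_mono)
        have *: "1 / sqrt (pi - \<bar>t\<bar>) \<le> ?g t" if "\<bar>t\<bar> < pi" for t
          using that by (cases "t \<ge> 0") (auto simp: indicator_def)
        show "1 / sqrt u \<le> ?g (fst p)" "1 / sqrt v \<le> ?g (snd p)"
          using *[of "fst p"] *[of "snd p"] p by (auto simp: u_def v_def)
        show "0 \<le> ?g (fst p)" by (auto simp: indicator_def)
      qed (use uv in auto)
      finally have "1 / sqrt (?w p) \<le> 3 * (?g (fst p) * ?g (snd p))" .
      moreover have "0 \<le> 1 / sqrt (?w p)"
      proof -
        have "0 \<le> (1 / 3) * (1 / 3) * (u * v)" using uv by simp
        then show ?thesis using w by simp
      qed
      ultimately show "norm (1 / sqrt (?w p)) \<le> norm (3 * (?g (fst p) * ?g (snd p)))" by simp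
    qed
  qed
qed

text \<open>The function \<open>1 / profile ES\<close> behaves like the inverse square of the distance to
  \<open>(pi, pi)\<close>, which is scale invariant in dimension two. So the integrals of \<open>h\<close> over
  squares of side \<open>s / 2\<close> at distance about \<open>s\<close> from the corner stay bounded below, whereas
  dominated convergence would force them to \<open>0\<close> as the squares shrink to the corner. The sign
  \<open>\<sigma>\<close> selects the corner \<open>(pi, pi)\<close> or \<open>(pi, -pi)\<close>; these are the same point of the
  torus, approached from two different quadrants.\<close>

lemma inverse_profile_ES_not_integrable:
  fixes h :: "real \<times> real \<Rightarrow> real"
  assumes \<sigma>: "\<sigma> \<in> {1, - 1 :: real}" and k: "k > 0"
    and ge: "\<And>x y. 0 < x \<Longrightarrow> x < 1 \<Longrightarrow> 0 < y \<Longrightarrow> y < 1 \<Longrightarrow>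
      h (pi - x, \<sigma> * (pi - y)) \<ge> k / profile ES (pi - x, \<sigma> * (pi - y))"
  shows "\<not> integrable torus h"
proof
  assume h: "integrable torus h"
  \<comment> \<open>The value of \<open>s\<close> stays below \<open>1\<close> so that \<open>ge\<close> applies on all squares.\<close>
  define s where "s = (\<lambda>n::nat. 1 / (real n + 2))"
  have s: "0 < s n" "s n < 1" for n by (auto simp: s_def)
  have s0: "s \<longlonglongrightarrow> 0"
  proof -
    have "(\<lambda>n. 1 / real (n + 2)) \<longlonglongrightarrow> 0" by (rule LIMSEQ_ignore_initial_segment[OF lim_1_over_n])
    then show ?thesis by (simp add: s_def[abs_def] add.commute)
  qed
  define I where "I = (\<lambda>n. if \<sigma> = 1 then cbox (pi - s n) (pi - s n / 2) else cbox (- (pi - s n / 2)) (- (pi - s n)))"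
  define Q where "Q = (\<lambda>n. cbox (pi - s n) (pi - s n / 2) \<times> I n)"
  have Qm: "Q n \<in> sets lebesgue" for n
  proof -
    obtain a b where "I n = cbox a b" unfolding I_def by metis
    then have "Q n = cbox (pi - s n, a) (pi - s n / 2, b)" by (simp only: Q_def cbox_Pair_eq)
    then show ?thesis by simp
  qed
  have Qxy: "\<exists>x y. p = (pi - x, \<sigma> * (pi - y)) \<and> s n / 2 \<le> x \<and> x \<le> s n \<and> s n / 2 \<le> y \<and> y \<le> s n"
    if "p \<in> Q n" for p n
    using that \<sigma>
    by (intro exI[of _ "pi - fst p"] exI[of _ "pi - \<sigma> * snd p"]) (auto simp: Q_def I_def)
  have QT: "Q n \<subseteq> T2" for n
    using s[of n] pi_gt3 \<sigma> unfolding Q_def I_def T2_def by auto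
  have meas: "measure torus (Q n) = (s n)\<^sup>2 / 4" for n
  proof -
    have "measure torus (Q n) = measure lebesgue (Q n)"
      using QT Qm by (subst measure_restrict_space) auto
    also have "\<dots> = measure lborel (cbox (pi - s n) (pi - s n / 2)) * measure lborel (I n)"
    proof -
      obtain a b where I: "I n = cbox a b" unfolding I_def by metis
      then have "Q n = cbox (pi - s n, a) (pi - s n / 2, b)" by (simp only: Q_def cbox_Pair_eq)
      then show ?thesis by (simp only: I content_Pair measure_completion sets_lborel borel_closed closed_cbox)
    qed
    also have "\<dots> = (s n / 2) * (s n / 2)"
      using s[of n] unfolding I_def by auto
    finally show ?thesis by (simp add: power2_eq_square)
  qed
  have ge_Q: "indicator (Q n) p * (k / (s n)\<^sup>2) \<le> indicator (Q n) p * h p" for n p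
  proof (cases "p \<in> Q n")
    case True
    obtain x y where p: "p = (pi - x, \<sigma> * (pi - y))" and xy: "s n / 2 \<le> x" "x \<le> s n" "s n / 2 \<le> y" "y \<le> s n"
      using Qxy[OF True] by blast
    have xy0: "0 < x" "x < 1" "0 < y" "y < 1" using xy s[of n] by auto
    have w: "profile ES p = (1 - cos x) + (1 - cos y)"
      using \<sigma> by (auto simp: p cos_diff)
    have "x\<^sup>2 \<le> (s n)\<^sup>2" "y\<^sup>2 \<le> (s n)\<^sup>2" using xy xy0 by (auto intro!: power_mono)
    then have "profile ES p \<le> (s n)\<^sup>2"
      unfolding w using one_minus_cos_le[of x] one_minus_cos_le[of y] by linarith
    moreover have "0 < profile ES p"
    proof -
      have "x\<^sup>2 / 18 \<le> 1 - cos x" using xy0 pi_gt3 by (intro one_minus_cos_ge) auto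
      moreover have "0 < x\<^sup>2 / 18" using xy0 by simp
      ultimately show ?thesis unfolding w using cos_le_one[of y] by linarith
    qed
    ultimately have "k / (s n)\<^sup>2 \<le> k / profile ES p"
      using k by (intro frac_le) auto
    also have "\<dots> \<le> h p" unfolding p by (rule ge) (use xy0 in auto)
    finally show ?thesis using True by simp
  qed simp
  have Qm': "Q n \<in> sets torus" for n
    using Qm QT by (auto simp: sets_restrict_space_iff)
  interpret finite_measure torus by (rule finite_measure_torus)
  have hm: "h \<in> borel_measurable torus" using h by auto
  have int: "integrable torus (\<lambda>p. indicator (Q n) p * h p)" for n
    using integrable_mult_indicator[OF Qm' h, of n] by simp
  \<comment> \<open>The area \<open>s\<^sup>2 / 4\<close> of the square cancels the bound \<open>k / s\<^sup>2\<close> of the integrand.\<close>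
  have lower: "k / 4 \<le> (LINT p|torus. indicator (Q n) p * h p)" for n
  proof -
    have "k / 4 = measure torus (Q n) * (k / (s n)\<^sup>2)"
      using s[of n] by (simp add: meas)
    also have "\<dots> = (LINT p|torus. indicator (Q n) p * (k / (s n)\<^sup>2))"
      using Qm'[of n] QT[of n] by (simp add: Int_absorb2)
    also have "\<dots> \<le> (LINT p|torus. indicator (Q n) p * h p)"
      using Qm' by (intro integral_mono int ge_Q integrable_mult_left integrable_real_indicator)
        (auto simp: less_top[symmetric])
    finally show ?thesis .
  qed
  have "(\<lambda>n. LINT p|torus. indicator (Q n) p * h p) \<longlonglongrightarrow> (LINT p|torus. 0)"
  proof (rule integral_dominated_convergence)
    show "integrable torus (\<lambda>p. \<bar>h p\<bar>)" using h by simp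
    show "AE p in torus. (\<lambda>n. indicator (Q n) p * h p) \<longlonglongrightarrow> 0"
    proof (rule AE_I2)
      fix p :: "real \<times> real"
      have "\<forall>\<^sub>F n in sequentially. p \<notin> Q n"
      proof (cases "fst p < pi")
        case True
        then have "\<forall>\<^sub>F n in sequentially. s n < pi - fst p"
          using order_tendstoD(2)[OF s0] by simp
        then show ?thesis by eventually_elim (auto simp: Q_def)
      next
        case False
        have "p \<notin> Q n" for n using False s[of n] by (auto simp: Q_def)
        then show ?thesis by simp
      qed
      then have "\<forall>\<^sub>F n in sequentially. indicator (Q n) p * h p = 0"
        by eventually_elim simp
      then show "(\<lambda>n. indicator (Q n) p * h p) \<longlonglongrightarrow> 0"
        by (rule tendsto_eventually)
    qed
    show "AE p in torus. norm (indicator (Q n) p * h p) \<le> \<bar>h p\<bar>" for n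
      by (auto simp: indicator_def)
  qed (use int in auto)
  then have "k / 4 \<le> (LINT p|torus. 0 :: real)"
    by (rule LIMSEQ_le_const) (use lower in auto)
  then show False using k by simp
qed

section \<open>The interaction on the sectors\<close>

lemma Lr_1_integrable: "f \<in> Lr 1 \<longleftrightarrow> integrable torus f"
  by (auto simp: Lr_def integrable_norm_iff)

definition moment :: "(real \<times> real \<Rightarrow> real) \<Rightarrow> (real \<times> real \<Rightarrow> complex) \<Rightarrow> complex" where
  "moment h f = (LINT q|torus. complex_of_real (h q) * f q)"

lemma moment_cong_AE:
  assumes "AE p in torus. f p = g p" "f \<in> borel_measurable torus" "g \<in> borel_measurable torus"
    and [measurable]: "h \<in> borel_measurable borel"
  shows "moment h f = moment h g"
proof -
  have [measurable]: "(\<lambda>q. complex_of_real (h q)) \<in> borel_measurable torus"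
    by (rule borel_measurable_torus) measurable
  show ?thesis
    unfolding moment_def using assms by (intro integral_cong_AE) auto
qed

text \<open>When \<open>s * t\<close> is \<open>- 1\<close> this says that the moment vanishes.\<close>

lemma moment_reflect:
  assumes f: "f \<in> borel_measurable torus" and sym: "AE p in torus. f (- p) = t * f p"
    and h: "h \<in> borel_measurable borel" "\<And>q. h (- q) = s * h q"
  shows "moment h f = complex_of_real s * t * moment h f"
proof -
  let ?k = "\<lambda>q. complex_of_real (h q) * f q"
  have [measurable]: "(\<lambda>q. complex_of_real (h q)) \<in> borel_measurable torus"
    using h by (intro borel_measurable_torus) measurable
  have k: "?k \<in> borel_measurable torus" using f by measurable
  have "moment h f = (LINT q|torus. ?k (- q))"
    unfolding moment_def by (rule torus_reflect(2)[OF k, symmetric])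
  also have "\<dots> = (LINT q|torus. complex_of_real s * t * ?k q)"
  proof (rule integral_cong_AE)
    show "(\<lambda>q. ?k (- q)) \<in> borel_measurable torus" by (rule torus_reflect(1)[OF k])
    show "AE q in torus. ?k (- q) = complex_of_real s * t * ?k q"
      using sym by eventually_elim (simp add: h)
  qed (use k in measurable)
  also have "\<dots> = complex_of_real s * t * moment h f"
    by (simp add: moment_def)
  finally show ?thesis .
qed

lemma moment_swap:
  assumes f: "f \<in> borel_measurable torus" and sym: "AE p in torus. f p = t * f (snd p, fst p)"
    and t: "t * t = 1" and h: "h \<in> borel_measurable borel"
  shows "moment (\<lambda>q. h (snd q, fst q)) f = t * moment h f"
proof -
  let ?k = "\<lambda>q. complex_of_real (h (snd q, fst q)) * f q"
  have [measurable]: "(\<lambda>q::real\<times>real. (snd q, fst q)) \<in> borel_measurable borel"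
    by (intro borel_measurable_continuous_onI continuous_intros)
  have "(\<lambda>q. h (snd q, fst q)) \<in> borel_measurable borel"
    by (rule measurable_compose[OF _ h]) measurable
  then have "(\<lambda>q. complex_of_real (h (snd q, fst q))) \<in> borel_measurable torus"
    by (intro borel_measurable_torus) measurable
  then have k: "?k \<in> borel_measurable torus" using f by measurable
  have hm: "(\<lambda>q. complex_of_real (h q)) \<in> borel_measurable torus"
    using h by (intro borel_measurable_torus) measurable
  have "moment (\<lambda>q. h (snd q, fst q)) f = (LINT q|torus. ?k (snd q, fst q))"
    unfolding moment_def by (rule torus_swap(2)[OF k, symmetric])
  also have "\<dots> = (LINT q|torus. t * (complex_of_real (h q) * f q))"
  proof (rule integral_cong_AE)
    show "(\<lambda>q. ?k (snd q, fst q)) \<in> borel_measurable torus" by (rule torus_swap(1)[OF k])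
    show "AE q in torus. ?k (snd q, fst q) = t * (complex_of_real (h q) * f q)"
      using sym
    proof eventually_elim
      case (elim q)
      have "t * f q = (t * t) * f (snd q, fst q)" using elim by (simp add: mult.assoc)
      then show ?case by (simp add: t mult_ac)
    qed
  qed (use hm f in measurable)
  also have "\<dots> = t * moment h f"
    by (simp add: moment_def)
  finally show ?thesis .
qed

text \<open>The addition theorem for the cosine shows that the interaction has rank at most five: its value on
  \<open>f\<close> is a trigonometric polynomial determined by five moments of \<open>f\<close>.\<close>

lemma kernel_expansion:
  assumes f: "integrable torus f"
  shows "(LINT q|torus. complex_of_real (a + 2 * b * (cos (fst p - fst q) + cos (snd p - snd q))) * f q)
    = of_real a * moment (\<lambda>_. 1) f
      + of_real (2 * b) * (of_real (cos (fst p)) * moment (\<lambda>q. cos (fst q)) f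
        + of_real (sin (fst p)) * moment (\<lambda>q. sin (fst q)) f
        + of_real (cos (snd p)) * moment (\<lambda>q. cos (snd q)) f
        + of_real (sin (snd p)) * moment (\<lambda>q. sin (snd q)) f)"
proof -
  have i [simp]: "integrable torus (\<lambda>q. complex_of_real (h q) * f q)"
    if "continuous_on UNIV h" "\<And>q. \<bar>h q\<bar> \<le> 1" for h
    by (rule integrable_torus_mult_bounded[OF f borel_measurable_continuous_onI]) (use that in auto)
  have [simp]: "continuous_on UNIV (\<lambda>q :: real \<times> real. cos (fst q))" "continuous_on UNIV (\<lambda>q :: real \<times> real. sin (fst q))"
    "continuous_on UNIV (\<lambda>q :: real \<times> real. cos (snd q))" "continuous_on UNIV (\<lambda>q :: real \<times> real. sin (snd q))"
    by (intro continuous_intros)+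
  have "(LINT q|torus. complex_of_real (a + 2 * b * (cos (fst p - fst q) + cos (snd p - snd q))) * f q)
    = (LINT q|torus. of_real a * f q
      + (of_real (2 * b * cos (fst p)) * (of_real (cos (fst q)) * f q)
      + (of_real (2 * b * sin (fst p)) * (of_real (sin (fst q)) * f q)
      + (of_real (2 * b * cos (snd p)) * (of_real (cos (snd q)) * f q)
      + of_real (2 * b * sin (snd p)) * (of_real (sin (snd q)) * f q)))))"
    by (intro Bochner_Integration.integral_cong refl) (simp add: cos_diff algebra_simps)
  also have "\<dots> = of_real a * moment (\<lambda>_. 1) f
      + (of_real (2 * b * cos (fst p)) * moment (\<lambda>q. cos (fst q)) f
      + (of_real (2 * b * sin (fst p)) * moment (\<lambda>q. sin (fst q)) f
      + (of_real (2 * b * cos (snd p)) * moment (\<lambda>q. cos (snd q)) f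
      + of_real (2 * b * sin (snd p)) * moment (\<lambda>q. sin (snd q)) f)))"
    unfolding moment_def using f by simp
  finally show ?thesis by (simp add: algebra_simps)
qed

lemma moment_linear:
  assumes "integrable torus f" "continuous_on UNIV g" "continuous_on UNIV h"
    "\<And>q. \<bar>g q\<bar> \<le> B" "\<And>q. \<bar>h q\<bar> \<le> B"
  shows "moment (\<lambda>q. g q + h q) f = moment g f + moment h f"
    and "moment (\<lambda>q. g q - h q) f = moment g f - moment h f"
proof -
  have "integrable torus (\<lambda>q. complex_of_real (g q) * f q)" "integrable torus (\<lambda>q. complex_of_real (h q) * f q)"
    using assms by (auto intro!: integrable_torus_mult_bounded borel_measurable_continuous_onI)
  then show "moment (\<lambda>q. g q + h q) f = moment g f + moment h f"
    and "moment (\<lambda>q. g q - h q) f = moment g f - moment h f"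
    unfolding moment_def by (simp_all add: ring_distribs)
qed

text \<open>Parity removes the moments of the other parity, and antisymmetry removes the mean; swapping the
  coordinates relates the moments in the second coordinate to those in the first.\<close>

lemma sector_moments:
  assumes f: "f \<in> Lr_sector 1 \<omega>"
  shows "\<omega> \<in> {OS, OA} \<Longrightarrow> moment (\<lambda>_. 1) f = 0"
    "\<omega> \<in> {OS, OA} \<Longrightarrow> moment (\<lambda>q. cos (fst q)) f = 0"
    "\<omega> \<in> {EA, ES} \<Longrightarrow> moment (\<lambda>q. sin (fst q)) f = 0"
    "\<omega> = EA \<Longrightarrow> moment (\<lambda>_. 1) f = 0"
    "moment (\<lambda>q. cos (snd q)) f = swap_sign \<omega> * moment (\<lambda>q. cos (fst q)) f"
    "moment (\<lambda>q. sin (snd q)) f = swap_sign \<omega> * moment (\<lambda>q. sin (fst q)) f"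
proof -
  have fm: "f \<in> borel_measurable torus"
    and par: "AE p in torus. f (- p) = parity_sign \<omega> * f p"
    and sw: "AE p in torus. f p = swap_sign \<omega> * f (snd p, fst p)"
    using f by (auto simp: Lr_sector_def Lr_def)
  have ss: "swap_sign \<omega> * swap_sign \<omega> = 1" by (cases \<omega>) auto
  have [measurable]: "(\<lambda>q :: real \<times> real. cos (fst q)) \<in> borel_measurable borel" "(\<lambda>q :: real \<times> real. sin (fst q)) \<in> borel_measurable borel"
    by (intro borel_measurable_continuous_onI continuous_intros)+
  have z: "z = - z \<Longrightarrow> z = 0" for z :: complex
    by simp
  show "\<omega> \<in> {OS, OA} \<Longrightarrow> moment (\<lambda>_. 1) f = 0"
    using moment_reflect[OF fm par, of "\<lambda>_. 1" 1] by (intro z) auto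
  show "\<omega> \<in> {OS, OA} \<Longrightarrow> moment (\<lambda>q. cos (fst q)) f = 0"
    using moment_reflect[OF fm par, of "\<lambda>q. cos (fst q)" 1] by (intro z) auto
  show "\<omega> \<in> {EA, ES} \<Longrightarrow> moment (\<lambda>q. sin (fst q)) f = 0"
    using moment_reflect[OF fm par, of "\<lambda>q. sin (fst q)" "- 1"] by (intro z) auto
  show "\<omega> = EA \<Longrightarrow> moment (\<lambda>_. 1) f = 0"
    using moment_swap[OF fm sw ss, of "\<lambda>_. 1"] by (intro z) auto
  show "moment (\<lambda>q. cos (snd q)) f = swap_sign \<omega> * moment (\<lambda>q. cos (fst q)) f"
    using moment_swap[OF fm sw ss, of "\<lambda>q. cos (fst q)"] by simp
  show "moment (\<lambda>q. sin (snd q)) f = swap_sign \<omega> * moment (\<lambda>q. sin (fst q)) f"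
    using moment_swap[OF fm sw ss, of "\<lambda>q. sin (fst q)"] by simp
qed

lemma sector_integrable: "f \<in> Lr_sector 1 \<omega> \<Longrightarrow> integrable torus f"
  using Lr_1_integrable by (auto simp: Lr_sector_def)

text \<open>On the odd sectors and on the even antisymmetric one the moments that survive combine into a
  single one, so the interaction has rank at most one with range spanned by the profile of the sector.\<close>

lemma kernel_on_sector:
  assumes f: "f \<in> Lr_sector 1 \<omega>" and \<omega>: "\<omega> \<noteq> ES"
  shows "(LINT q|torus. complex_of_real (a + 2 * b * (cos (fst p - fst q) + cos (snd p - snd q))) * f q)
    = of_real (b * profile \<omega> p) * moment (profile \<omega>) f"
proof -
  note i = sector_integrable[OF f]
  have "moment (profile OS) f = moment (\<lambda>q. sin (fst q)) f + moment (\<lambda>q. sin (snd q)) f"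
    "moment (profile OA) f = moment (\<lambda>q. sin (fst q)) f - moment (\<lambda>q. sin (snd q)) f"
    "moment (profile EA) f = moment (\<lambda>q. cos (fst q)) f - moment (\<lambda>q. cos (snd q)) f"
    unfolding profile_eq by (rule moment_linear[OF i, where B = 1]; auto intro!: continuous_intros)+
  then show ?thesis
    unfolding kernel_expansion[OF i] using sector_moments[OF f] \<omega>
    by (cases \<omega>) (auto simp: algebra_simps)
qed

text \<open>On the even symmetric sector two independent moments remain, which is the reason why a nonzero solution
  exists only under a condition on \<open>a\<close> and \<open>b\<close>.\<close>

lemma kernel_on_ES:
  assumes f: "f \<in> Lr_sector 1 ES"
  shows "(LINT q|torus. complex_of_real (a + 2 * b * (cos (fst p - fst q) + cos (snd p - snd q))) * f q)
    = of_real a * moment (\<lambda>_. 1) f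
      + of_real (b * (cos (fst p) + cos (snd p))) * moment (\<lambda>q. cos (fst q) + cos (snd q)) f"
proof -
  note i = sector_integrable[OF f]
  have "moment (\<lambda>q. cos (fst q) + cos (snd q)) f = moment (\<lambda>q. cos (fst q)) f + moment (\<lambda>q. cos (snd q)) f"
    by (rule moment_linear[OF i, where B = 1]; auto intro!: continuous_intros)
  then show ?thesis
    unfolding kernel_expansion[OF i] using sector_moments[OF f]
    by (simp add: algebra_simps)
qed

section \<open>Threshold solutions\<close>

text \<open>What the threshold analysis uses of the dispersion: its symmetries, and that
  its gap below the maximum is comparable to \<open>profile ES\<close> and vanishes at one point only.\<close>

locale threshold_gap =
  fixes e :: "real \<times> real \<Rightarrow> real" and c C :: real
  assumes continuous: "continuous_on UNIV e"
    and even: "\<And>p. e (- p) = e p"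
    and symm: "\<And>p1 p2. e (p1, p2) = e (p2, p1)"
    and c: "c > 0" and C: "C > 0"
    and gap_ge: "\<And>p. p \<in> T2 \<Longrightarrow> c * profile ES p \<le> emax e - e p"
    and gap_le: "\<And>p. p \<in> T2 \<Longrightarrow> emax e - e p \<le> C * profile ES p"
    and gap_pos: "\<And>p. p \<in> T2 \<Longrightarrow> p \<noteq> (pi, pi) \<Longrightarrow> 0 < emax e - e p"
begin

lemma profile_ES_nonneg: "0 \<le> profile ES p"
  unfolding profile.simps using cos_ge_minus_one[of "fst p"] cos_ge_minus_one[of "snd p"] by linarith

lemma gap_measurable [measurable]: "(\<lambda>p. emax e - e p) \<in> borel_measurable borel"
  using borel_measurable_continuous_onI[OF continuous] by measurable

lemma quotient_measurable [measurable]: "(\<lambda>p. profile \<omega> p / (emax e - e p)) \<in> borel_measurable borel"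
  by measurable

lemma Phi_measurable: "Phi e \<omega> \<in> borel_measurable torus"
  unfolding Phi_def[abs_def] by (rule borel_measurable_torus) measurable

lemma norm_Phi: "norm (Phi e \<omega> p) = \<bar>profile \<omega> p / (emax e - e p)\<bar>"
  by (simp only: Phi_def norm_of_real)

lemma gap_nonneg: "p \<in> T2 \<Longrightarrow> 0 \<le> emax e - e p"
  by (rule order_trans[OF mult_nonneg_nonneg[OF less_imp_le[OF c] profile_ES_nonneg] gap_ge])

lemma AE_gap_pos: "AE p in torus. 0 < emax e - e p"
proof -
  have "AE p in torus. p \<in> T2" by (simp add: AE_torus_iff)
  with AE_torus_off_edges show ?thesis
    by eventually_elim (auto simp only: intro!: gap_pos, auto)
qed

text \<open>The even profiles are bounded by \<open>profile ES\<close>, hence by a multiple of the gap.\<close>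

lemma even_profile_bound:
  assumes "\<omega> \<in> {EA, ES}" "p \<in> T2"
  shows "\<bar>profile \<omega> p / (emax e - e p)\<bar> \<le> 1 / c"
proof (cases "emax e - e p = 0")
  case True
  show ?thesis unfolding True using c by simp
next
  case False
  then have D: "0 < emax e - e p" using gap_nonneg[OF assms(2)] by linarith
  have "\<bar>profile \<omega> p\<bar> \<le> profile ES p"
    using assms(1) cos_ge_minus_one[of "fst p"] cos_ge_minus_one[of "snd p"]
    by (auto simp: abs_le_iff simp del: cos_ge_minus_one)
  then have "c * \<bar>profile \<omega> p\<bar> \<le> emax e - e p"
    by (rule order_trans[OF mult_left_mono[OF _ less_imp_le[OF c]] gap_ge[OF assms(2)]])
  then show ?thesis
    using D c by (simp add: abs_divide divide_simps mult.commute)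
qed

text \<open>By \<open>sin\<^sup>2 t = (1 - cos t) (1 + cos t)\<close> the odd profiles are of the order of the square root of
  \<open>profile ES\<close>, that is, they vanish to first order only.\<close>

lemma odd_profile_bound:
  assumes "\<omega> \<in> {OS, OA}" "p \<in> T2"
  shows "\<bar>profile \<omega> p / (emax e - e p)\<bar> \<le> 2 / c * (1 / sqrt (profile ES p))"
proof (cases "emax e - e p = 0")
  case True
  show ?thesis unfolding True using c profile_ES_nonneg[of p] by simp
next
  case False
  then have D: "0 < emax e - e p" using gap_nonneg[OF assms(2)] by linarith
  let ?w = "profile ES p"
  have w: "0 < ?w" by (rule zero_less_mult_pos[OF less_le_trans[OF D gap_le[OF assms(2)]] C])
  have sin2: "(sin t)\<^sup>2 \<le> 2 * (1 + cos t)" for t :: real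
  proof -
    have "(sin t)\<^sup>2 = (1 - cos t) * (1 + cos t)"
      using sin_cos_squared_add[of t] by (simp add: power2_eq_square algebra_simps)
    also have "\<dots> \<le> 2 * (1 + cos t)"
      using cos_ge_minus_one[of t] by (intro mult_right_mono; linarith)
    finally show ?thesis .
  qed
  have "(profile \<omega> p)\<^sup>2 \<le> 2 * (sin (fst p))\<^sup>2 + 2 * (sin (snd p))\<^sup>2"
    using assms(1) sum_squares_bound[of "sin (fst p)" "sin (snd p)"]
      sum_squares_bound[of "sin (fst p)" "- sin (snd p)"]
    by (auto simp: power2_sum power2_diff)
  also have "\<dots> \<le> 2\<^sup>2 * ?w"
    using sin2[of "fst p"] sin2[of "snd p"] by (simp del: cos_ge_minus_one)
  finally have "sqrt ((profile \<omega> p)\<^sup>2) \<le> sqrt (2\<^sup>2 * ?w)" by (rule real_sqrt_le_mono)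
  then have b: "\<bar>profile \<omega> p\<bar> \<le> 2 * sqrt ?w" by (simp only: real_sqrt_mult real_sqrt_abs abs_numeral)
  have "\<bar>profile \<omega> p / (emax e - e p)\<bar> = \<bar>profile \<omega> p\<bar> / (emax e - e p)"
    using D by (simp add: abs_divide)
  also have "\<dots> \<le> (2 * sqrt ?w) / (c * ?w)"
    using b D w c gap_ge[OF assms(2)] by (intro frac_le) auto
  also have "\<dots> = 2 / c * (sqrt ?w / ?w)" by simp
  also have "sqrt ?w / ?w = 1 / sqrt ?w" by (simp only: sqrt_divide_self_eq[OF less_imp_le[OF w]] inverse_eq_divide)
  finally show ?thesis .
qed

lemma quotient_integrable: "integrable torus (\<lambda>p. profile \<omega> p / (emax e - e p))"
proof (cases "\<omega> \<in> {EA, ES}")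
  case True
  then show ?thesis
    using even_profile_bound by (intro integrable_torus_bounded[of _ "1 / c"] borel_measurable_torus) auto
next
  case False
  then have \<omega>: "\<omega> \<in> {OS, OA}" by (cases \<omega>) auto
  have "integrable torus (\<lambda>p. 2 / c * (1 / sqrt (profile ES p)))"
    by (intro integrable_mult_right inverse_sqrt_profile_ES_integrable)
  then show ?thesis
  proof (rule Bochner_Integration.integrable_bound)
    show "AE p in torus. norm (profile \<omega> p / (emax e - e p)) \<le> norm (2 / c * (1 / sqrt (profile ES p)))"
    proof (rule AE_I2)
      fix p assume "p \<in> space torus"
      then have "\<bar>profile \<omega> p / (emax e - e p)\<bar> \<le> 2 / c * (1 / sqrt (profile ES p))"
        using odd_profile_bound[OF \<omega>] by simp
      then show "norm (profile \<omega> p / (emax e - e p)) \<le> norm (2 / c * (1 / sqrt (profile ES p)))"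
        unfolding real_norm_def by linarith
    qed
  qed (intro borel_measurable_torus quotient_measurable)
qed

lemma Phi_in_sector:
  assumes "Phi e \<omega> \<in> Lr r"
  shows "Phi e \<omega> \<in> Lr_sector r \<omega>"
proof -
  have "Phi e \<omega> (- p) = parity_sign \<omega> * Phi e \<omega> p" for p
    using even[of p] by (cases \<omega>) (auto simp: Phi_def minus_divide_left[symmetric] diff_divide_distrib add_divide_distrib)
  moreover have "Phi e \<omega> p = swap_sign \<omega> * Phi e \<omega> (snd p, fst p)" for p
    using symm[of "fst p" "snd p"] by (cases \<omega>) (auto simp: Phi_def diff_divide_distrib add_divide_distrib)
  ultimately show ?thesis
    unfolding Lr_sector_def using assms by blast
qed

lemma Phi_L1: "Phi e \<omega> \<in> Lr_sector 1 \<omega>"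
  unfolding Phi_def[abs_def]
  by (rule Phi_in_sector[unfolded Phi_def[abs_def]], subst Lr_1_integrable)
    (intro integrable_of_real quotient_integrable)

lemma Phi_L2_even: 
  assumes "\<omega> \<in> {EA, ES}"
  shows "Phi e \<omega> \<in> Lr_sector 2 \<omega>"
proof (rule Phi_in_sector)
  have "norm (norm (Phi e \<omega> p) ^ 2) \<le> (1 / c)\<^sup>2" if "p \<in> T2" for p
    using power_mono[OF even_profile_bound[OF assms that] abs_ge_zero, of 2]
    by (simp only: norm_Phi real_norm_def abs_power2)
  then have "integrable torus (\<lambda>p. norm (Phi e \<omega> p) ^ 2)"
    using Phi_measurable[of \<omega>] by (intro integrable_torus_bounded[of _ "(1 / c)\<^sup>2"]) auto
  then show "Phi e \<omega> \<in> Lr 2"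
    using Phi_measurable by (simp add: Lr_def)
qed

text \<open>In a quadrant where both terms of the odd profile have the same sign, its square is at
  least \<open>profile ES\<close>, so the squared modulus of \<open>Phi\<close> dominates a multiple of
  \<open>1 / profile ES\<close>. For \<open>OA\<close> such a quadrant lies at the corner \<open>(pi, -pi)\<close>.\<close>

lemma Phi_not_L2_odd:
  assumes "\<omega> \<in> {OS, OA}"
  shows "Phi e \<omega> \<notin> Lr_sector 2 \<omega>"
proof
  assume "Phi e \<omega> \<in> Lr_sector 2 \<omega>"
  then have int: "integrable torus (\<lambda>p. norm (Phi e \<omega> p) ^ 2)"
    by (simp add: Lr_sector_def Lr_def)
  define \<sigma> :: real where "\<sigma> = (if \<omega> = OS then 1 else - 1)"
  have "\<not> integrable torus (\<lambda>p. norm (Phi e \<omega> p) ^ 2)"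
  proof (rule inverse_profile_ES_not_integrable[of \<sigma> "1 / C\<^sup>2"])
    show "\<sigma> \<in> {1, - 1}" by (simp add: \<sigma>_def)
    show "0 < 1 / C\<^sup>2" using C by simp
    fix x y :: real assume xy: "0 < x" "x < 1" "0 < y" "y < 1"
    let ?p = "(pi - x, \<sigma> * (pi - y))"
    let ?w = "profile ES ?p" and ?D = "emax e - e ?p"
    have pT: "?p \<in> T2" "?p \<noteq> (pi, pi)"
      using xy pi_gt3 by (auto simp: T2_def \<sigma>_def)
    have D: "0 < ?D" by (rule gap_pos[OF pT])
    have w: "0 < ?w" by (rule zero_less_mult_pos[OF less_le_trans[OF D gap_le[OF pT(1)]] C])
    have w_eq: "?w = (1 - cos x) + (1 - cos y)" by (auto simp: \<sigma>_def cos_diff)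
    have sn: "0 \<le> sin x" "0 \<le> sin y" using xy pi_gt3 by (auto intro!: sin_ge_zero)
    have pr: "profile \<omega> ?p = sin x + sin y"
      using assms by (auto simp: \<sigma>_def sin_diff)
    have s2: "1 - cos t \<le> (sin t)\<^sup>2" if "0 < t" "t < 1" for t :: real
    proof -
      have "0 \<le> cos t" using that pi_gt3 by (intro cos_ge_zero) auto
      then have "(1 - cos t) * 1 \<le> (1 - cos t) * (1 + cos t)" by (intro mult_left_mono) auto
      also have "\<dots> = (sin t)\<^sup>2"
        using sin_cos_squared_add[of t] by (simp add: power2_eq_square algebra_simps)
      finally show ?thesis by simp
    qed
    have "?w \<le> (sin x)\<^sup>2 + (sin y)\<^sup>2" unfolding w_eq using s2 xy by (intro add_mono) auto
    also have "\<dots> \<le> (profile \<omega> ?p)\<^sup>2" unfolding pr using sn by (simp add: power2_sum)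
    finally have wp: "?w \<le> (profile \<omega> ?p)\<^sup>2" .
    have "1 / C\<^sup>2 / ?w = ?w / (C * ?w)\<^sup>2" using w C by (simp add: power2_eq_square)
    also have "\<dots> \<le> (profile \<omega> ?p)\<^sup>2 / ?D\<^sup>2"
      using wp w D gap_le[OF pT(1)] by (intro frac_le power_mono) auto
    also have "\<dots> = norm (Phi e \<omega> ?p) ^ 2"
      by (simp only: norm_Phi power2_abs power_divide)
    finally show "1 / C\<^sup>2 / ?w \<le> norm (Phi e \<omega> ?p) ^ 2" .
  qed
  then show False using int by simp
qed

text \<open>Up to the factor \<open>4 pi\<^sup>2\<close> this is the inverse of \<open>gam e \<omega>\<close>. It is also the moment of
  \<open>Phi\<close> against its own profile, which is why \<open>gam\<close> is the critical coupling.\<close>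

definition energy :: "sector \<Rightarrow> real" where
  "energy \<omega> = (LINT p|torus. (profile \<omega> p)\<^sup>2 / (emax e - e p))"

lemma profile_bounded: "\<bar>profile \<omega> p\<bar> \<le> 4"
  using cos_ge_minus_one[of "fst p"] cos_ge_minus_one[of "snd p"] cos_le_one[of "fst p"] cos_le_one[of "snd p"]
    sin_ge_minus_one[of "fst p"] sin_ge_minus_one[of "snd p"] sin_le_one[of "fst p"] sin_le_one[of "snd p"]
  by (cases \<omega>) (auto simp: abs_le_iff simp del: cos_ge_minus_one cos_le_one sin_ge_minus_one sin_le_one)

lemma bounded_mult_quotient_integrable:
  assumes "h \<in> borel_measurable borel" "\<And>p. \<bar>h p\<bar> \<le> B"
  shows "integrable torus (\<lambda>p. h p * profile \<omega> p / (emax e - e p))"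
proof -
  have "integrable torus (\<lambda>p. complex_of_real (h p) * complex_of_real (profile \<omega> p / (emax e - e p)))"
    by (intro integrable_torus_mult_bounded[OF _ assms] integrable_of_real quotient_integrable)
  then have "integrable torus (\<lambda>p. Re (complex_of_real (h p) * complex_of_real (profile \<omega> p / (emax e - e p))))"
    by (rule integrable_Re)
  then show ?thesis by simp
qed

lemma moment_Phi:
  "moment h (Phi e \<omega>) = complex_of_real (LINT p|torus. h p * profile \<omega> p / (emax e - e p))"
  unfolding moment_def Phi_def by (simp flip: integral_complex_of_real)

lemma moment_profile_Phi: "moment (profile \<omega>) (Phi e \<omega>) = complex_of_real (energy \<omega>)"
  unfolding energy_def by (simp add: moment_Phi power2_eq_square)

text \<open>Positivity matters because \<open>gam\<close> is an inverse: a vanishing integral would make it \<open>0\<close>.\<close>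

lemma energy_pos: "0 < energy \<omega>"
proof -
  have int: "integrable torus (\<lambda>p. (profile \<omega> p)\<^sup>2 / (emax e - e p))"
    using bounded_mult_quotient_integrable[OF profile_measurable profile_bounded] by (simp add: power2_eq_square)
  have nn: "AE p in torus. 0 \<le> (profile \<omega> p)\<^sup>2 / (emax e - e p)"
    using gap_nonneg by (intro AE_I2) simp
  have "energy \<omega> \<noteq> 0"
  proof
    assume "energy \<omega> = 0"
    then have "AE p in torus. (profile \<omega> p)\<^sup>2 / (emax e - e p) = 0"
      using integral_nonneg_eq_0_iff_AE[OF int nn] by (simp add: energy_def)
    with AE_gap_pos have "AE p in torus. profile \<omega> p = 0"
      by eventually_elim auto
    then show False using profile_not_AE_zero by blast
  qed
  moreover have "0 \<le> energy \<omega>" unfolding energy_def by (rule integral_nonneg_AE[OF nn])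
  ultimately show ?thesis by simp
qed

lemma gam_eq: "gam e \<omega> = 4 * pi\<^sup>2 / energy \<omega>"
  unfolding gam_def energy_def by simp

text \<open>The equation in the form in which it is solved: gap times function equals interaction.\<close>

lemma threshold_solution_iff:
  "threshold_solution e a b \<omega> f \<longleftrightarrow> f \<in> Lr_sector 1 \<omega> \<and>
     (AE p in torus. complex_of_real (emax e - e p) * f p = complex_of_real (mu0 e a b \<omega> / (4 * pi\<^sup>2)) *
       (LINT q|torus. complex_of_real (a + 2 * b * (cos (fst p - fst q) + cos (snd p - snd q))) * f q))"
proof -
  have "H_op e a b \<mu> f p = complex_of_real (emax e) * f p \<longleftrightarrow>
    complex_of_real (emax e - e p) * f p = complex_of_real (\<mu> / (4 * pi\<^sup>2)) *
       (LINT q|torus. complex_of_real (a + 2 * b * (cos (fst p - fst q) + cos (snd p - snd q))) * f q)" for \<mu> p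
    unfolding H_op_def of_real_diff left_diff_distrib by (simp only: diff_eq_eq) (auto simp: add.commute)
  then show ?thesis unfolding threshold_solution_def by simp
qed

lemma AE_gap_times_Phi: "AE p in torus. complex_of_real (emax e - e p) * Phi e \<omega> p = complex_of_real (profile \<omega> p)"
  using AE_gap_pos
proof eventually_elim
  case (elim p)
  then show ?case unfolding Phi_def of_real_mult[symmetric] by simp
qed

lemma Phi_solution:
  assumes "\<omega> \<noteq> ES" "b \<noteq> 0"
  shows "threshold_solution e a b \<omega> (Phi e \<omega>)"
proof -
  have "mu0 e a b \<omega> = gam e \<omega> / b" using assms by (cases \<omega>) auto
  then have "complex_of_real (mu0 e a b \<omega> / (4 * pi\<^sup>2)) * (of_real (b * profile \<omega> p) * of_real (energy \<omega>)) = of_real (profile \<omega> p)" for p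
    using energy_pos[of \<omega>] assms(2) unfolding of_real_mult[symmetric] by (simp add: gam_eq)
  then show ?thesis
    unfolding threshold_solution_iff kernel_on_sector[OF Phi_L1 assms(1)] moment_profile_Phi
    using Phi_L1 AE_gap_times_Phi by simp
qed

definition zeroth_moment_ES :: real where
  "zeroth_moment_ES = (LINT p|torus. profile ES p / (emax e - e p))"

definition cosine_moment_ES :: real where
  "cosine_moment_ES = (LINT p|torus. (cos (fst p) + cos (snd p)) * profile ES p / (emax e - e p))"

lemma cos_sum_bounds: "(\<lambda>q :: real \<times> real. cos (fst q) + cos (snd q)) \<in> borel_measurable borel"
  "\<bar>cos (fst q) + cos (snd q :: real)\<bar> \<le> 2" for q :: "real \<times> real"
proof -
  show "(\<lambda>q :: real \<times> real. cos (fst q) + cos (snd q)) \<in> borel_measurable borel"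
    by (intro borel_measurable_continuous_onI continuous_intros)
  show "\<bar>cos (fst q) + cos (snd q)\<bar> \<le> 2"
    using abs_cos_le_one[of "fst q"] abs_cos_le_one[of "snd q"] by linarith
qed

lemma moments_Phi_ES:
  "moment (\<lambda>_. 1) (Phi e ES) = of_real zeroth_moment_ES"
  "moment (\<lambda>q. cos (fst q) + cos (snd q)) (Phi e ES) = of_real cosine_moment_ES"
  unfolding zeroth_moment_ES_def cosine_moment_ES_def
  by (simp_all only: moment_Phi mult_1)

lemma Theta1_eq: "Theta1 e = zeroth_moment_ES / (4 * pi\<^sup>2)"
  unfolding Theta1_def zeroth_moment_ES_def by (simp add: add_ac)

lemma Theta2_eq: "Theta2 e = 2 * cosine_moment_ES / (4 * pi\<^sup>2)"
proof -
  have "(LINT p|torus. 2 * (cos (fst p) + cos (snd p)) * (2 + cos (fst p) + cos (snd p)) / (emax e - e p))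
    = (LINT p|torus. 2 * ((cos (fst p) + cos (snd p)) * profile ES p / (emax e - e p)))"
    by (intro Bochner_Integration.integral_cong refl) (simp add: add_ac)
  also have "\<dots> = 2 * cosine_moment_ES" unfolding cosine_moment_ES_def by (rule integral_mult_right_zero)
  finally show ?thesis unfolding Theta2_def by simp
qed

lemma energy_ES: "energy ES = 2 * zeroth_moment_ES + cosine_moment_ES"
proof -
  have "energy ES = (LINT p|torus. 2 * (profile ES p / (emax e - e p))
      + (cos (fst p) + cos (snd p)) * profile ES p / (emax e - e p))"
    unfolding energy_def
    by (intro Bochner_Integration.integral_cong refl) (simp add: power2_eq_square ring_distribs add_divide_distrib)
  also have "\<dots> = 2 * zeroth_moment_ES + cosine_moment_ES"
    unfolding zeroth_moment_ES_def cosine_moment_ES_def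
    using Bochner_Integration.integral_add[OF integrable_mult_right[OF quotient_integrable[of ES], of 2]
        bounded_mult_quotient_integrable[OF cos_sum_bounds, of ES]]
    by (simp only: integral_mult_right_zero)
  finally show ?thesis .
qed

lemma Theta_condition: "Theta1 e * a = Theta2 e * b \<longleftrightarrow> a * zeroth_moment_ES = 2 * b * cosine_moment_ES"
  unfolding Theta1_eq Theta2_eq by (simp add: field_simps)

text \<open>The interaction maps \<open>Phi\<close> to a combination of \<open>1\<close> and \<open>cos p1 + cos p2\<close>; the condition on
  the Theta integrals says exactly that this combination is proportional to \<open>profile ES\<close>, and it
  also evaluates \<open>gam e ES\<close> so that the factor of proportionality becomes \<open>1\<close>.\<close>

lemma Phi_ES_solution:
  assumes a: "a \<noteq> 0" and b: "b \<noteq> 0" and pos: "(a + 4 * b) / (a * b) > 0"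
    and cond: "Theta1 e * a = Theta2 e * b"
  shows "threshold_solution e a b ES (Phi e ES)"
proof -
  have J: "a * zeroth_moment_ES = 2 * b * cosine_moment_ES" using cond by (simp add: Theta_condition)
  have ab: "a + 4 * b \<noteq> 0" using pos by auto
  have "a * energy ES = (a + 4 * b) * cosine_moment_ES"
    using J by (simp add: energy_ES algebra_simps)
  then have E: "energy ES = (a + 4 * b) * cosine_moment_ES / a" using a by (simp add: field_simps)
  then have cosine_moment_ES: "cosine_moment_ES \<noteq> 0" using energy_pos[of ES] by auto
  have "mu0 e a b ES / (4 * pi\<^sup>2) = (a + 4 * b) / (a * b) / energy ES"
    by (simp add: gam_eq)
  also have "\<dots> = 1 / (b * cosine_moment_ES)"
    unfolding E using a b ab cosine_moment_ES by (simp add: divide_simps)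
  finally have \<mu>: "mu0 e a b ES / (4 * pi\<^sup>2) = 1 / (b * cosine_moment_ES)" .
  have "1 / (b * cosine_moment_ES) * (a * zeroth_moment_ES + b * (cos (fst p) + cos (snd p)) * cosine_moment_ES) = profile ES p" for p
  proof -
    have "a * zeroth_moment_ES + b * (cos (fst p) + cos (snd p)) * cosine_moment_ES = b * cosine_moment_ES * profile ES p"
      unfolding J by (simp add: algebra_simps)
    then show ?thesis using b cosine_moment_ES by simp
  qed
  then have eq: "complex_of_real (mu0 e a b ES / (4 * pi\<^sup>2)) * (of_real a * of_real zeroth_moment_ES + of_real (b * (cos (fst p) + cos (snd p))) * of_real cosine_moment_ES)
     = of_real (profile ES p)" for p
    unfolding \<mu> of_real_mult[symmetric] of_real_add[symmetric] by simp
  show ?thesis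
    unfolding threshold_solution_iff kernel_on_ES[OF Phi_L1] moments_Phi_ES eq
    by (intro conjI Phi_L1 AE_gap_times_Phi)
qed

text \<open>This makes \<open>L\<^sup>1\<close> membership a constraint: the numerator of a solution has to vanish
  at \<open>(pi, pi)\<close>.\<close>

lemma inverse_gap_not_integrable:
  assumes "integrable torus (\<lambda>p. z / complex_of_real (emax e - e p))"
  shows "z = 0"
proof (rule ccontr)
  assume z: "z \<noteq> 0"
  have "\<not> integrable torus (\<lambda>p. norm (z / complex_of_real (emax e - e p)))"
  proof (rule inverse_profile_ES_not_integrable[of 1 "norm z / C"])
    show "0 < norm z / C" using z C by simp
    fix x y :: real assume xy: "0 < x" "x < 1" "0 < y" "y < 1"
    let ?p = "(pi - x, 1 * (pi - y))"
    have pT: "?p \<in> T2" "?p \<noteq> (pi, pi)" using xy pi_gt3 by (auto simp: T2_def)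
    have D: "0 < emax e - e ?p" by (rule gap_pos[OF pT])
    have "norm z / C / profile ES ?p = norm z / (C * profile ES ?p)" by simp
    also have "\<dots> \<le> norm z / (emax e - e ?p)"
      using D gap_le[OF pT(1)] by (intro frac_le) auto
    also have "\<dots> = norm (z / complex_of_real (emax e - e ?p))"
      using D unfolding norm_divide norm_of_real by simp
    finally show "norm z / C / profile ES ?p \<le> norm (z / complex_of_real (emax e - e ?p))" .
  qed simp
  then show False using integrable_norm[OF assms] by simp
qed

text \<open>A solution is \<open>A + B (cos p1 + cos p2)\<close> divided by the gap. Integrability
  forces the numerator to vanish at \<open>(pi, pi)\<close>, so the solution is \<open>B\<close> times \<open>Phi e ES\<close>. Inserting
  this into the definitions of \<open>A\<close> and \<open>B\<close> gives \<open>B * (a * zeroth_moment_ES - 2 * b * cosine_moment_ES) = 0\<close>,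
  and the bracket is nonzero by the condition on the Theta integrals.\<close>

lemma only_zero_solution:
  assumes a: "a \<noteq> 0" and b: "b \<noteq> 0" and pos: "(a + 4 * b) / (a * b) > 0"
    and cond: "Theta1 e * a \<noteq> Theta2 e * b"
    and sol: "threshold_solution e a b ES f"
  shows "AE p in torus. f p = 0"
proof -
  define \<kappa> where "\<kappa> = mu0 e a b ES / (4 * pi\<^sup>2)"
  have \<kappa>: "\<kappa> \<noteq> 0" using pos energy_pos[of ES] by (auto simp: \<kappa>_def gam_eq)
  let ?D = "\<lambda>p. complex_of_real (emax e - e p)"
  have f: "f \<in> Lr_sector 1 ES" using sol by (simp add: threshold_solution_iff)
  note fi = sector_integrable[OF f]
  have fm: "f \<in> borel_measurable torus" using fi by auto
  define A where "A = of_real (\<kappa> * a) * moment (\<lambda>_. 1) f"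
  define B where "B = of_real (\<kappa> * b) * moment (\<lambda>q. cos (fst q) + cos (snd q)) f"
  have "AE p in torus. ?D p * f p = of_real \<kappa> * (of_real a * moment (\<lambda>_. 1) f
      + of_real (b * (cos (fst p) + cos (snd p))) * moment (\<lambda>q. cos (fst q) + cos (snd q)) f)"
    using sol unfolding threshold_solution_iff kernel_on_ES[OF f] \<kappa>_def by blast
  then have eq: "AE p in torus. ?D p * f p = (A - 2 * B) + B * of_real (profile ES p)"
    by eventually_elim (simp add: A_def B_def algebra_simps)
  \<comment> \<open>Split off the bounded part, so that the rest is a constant over the gap.\<close>
  have eq2: "AE p in torus. f p - B * Phi e ES p = (A - 2 * B) / ?D p"
    using eq AE_gap_pos
  proof eventually_elim
    case (elim p)
    then have D: "?D p \<noteq> 0" unfolding of_real_eq_0_iff by linarith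
    then have "f p = ((A - 2 * B) + B * of_real (profile ES p)) / ?D p"
      using elim(1) by (simp only: nonzero_eq_divide_eq mult.commute not_False_eq_True)
    then show ?case unfolding Phi_def of_real_divide by (simp only: add_divide_distrib) simp
  qed
  have Phi_i: "integrable torus (Phi e ES)" by (rule sector_integrable[OF Phi_L1])
  have i1: "integrable torus (\<lambda>p. f p - B * Phi e ES p)" using fi Phi_i by simp
  have mD: "(\<lambda>p. (A - 2 * B) / ?D p) \<in> borel_measurable torus"
    by (rule borel_measurable_torus) measurable
  have "integrable torus (\<lambda>p. (A - 2 * B) / ?D p)"
    using integrable_cong_AE[OF borel_measurable_integrable[OF i1] mD eq2] i1 by blast
  then have AB: "A = 2 * B" using inverse_gap_not_integrable by force
  have fB: "AE p in torus. f p = B * Phi e ES p"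
    using eq2 by eventually_elim (simp add: AB)
  have mom: "moment h f = B * moment h (Phi e ES)" if "h \<in> borel_measurable borel" for h
  proof -
    have "moment h f = moment h (\<lambda>p. B * Phi e ES p)"
      by (intro moment_cong_AE borel_measurable_times borel_measurable_const Phi_measurable that fB fm)
    also have "\<dots> = B * moment h (Phi e ES)"
      unfolding moment_def by (simp add: mult.left_commute)
    finally show ?thesis .
  qed
  have A: "A = of_real (\<kappa> * a) * (B * of_real zeroth_moment_ES)"
    unfolding A_def by (simp only: mom[OF borel_measurable_const] moments_Phi_ES)
  have B: "B = of_real (\<kappa> * b) * (B * of_real cosine_moment_ES)"
    by (subst B_def) (simp only: mom[OF cos_sum_bounds(1)] moments_Phi_ES)
  have "of_real (\<kappa> * a) * (B * of_real zeroth_moment_ES) = 2 * (of_real (\<kappa> * b) * (B * complex_of_real cosine_moment_ES))"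
    unfolding A[symmetric] B[symmetric] by (rule AB)
  then have "of_real \<kappa> * (B * of_real (a * zeroth_moment_ES - 2 * b * cosine_moment_ES)) = 0"
    by (simp only: of_real_mult of_real_diff of_real_numeral) (simp add: algebra_simps)
  moreover have "a * zeroth_moment_ES - 2 * b * cosine_moment_ES \<noteq> 0"
    using cond by (simp add: Theta_condition)
  ultimately have "B = 0" using \<kappa> unfolding mult_eq_0_iff of_real_eq_0_iff by blast
  then show ?thesis using fB by simp
qed

lemma zero_solution:
  assumes f: "f \<in> Lr_sector 1 \<omega>" and z: "AE p in torus. f p = 0"
  shows "threshold_solution e a b \<omega> f"
proof -
  have int0: "(LINT q|torus. complex_of_real (h q) * f q) = 0" for h
    using z by (intro integral_eq_zero_AE) (auto elim!: eventually_mono)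
  show ?thesis
    unfolding threshold_solution_iff int0 using f z by (auto elim!: eventually_mono)
qed

end

theorem theorem3p5:
  fixes ehat :: "int \<times> int \<Rightarrow> complex" and e :: "real \<times> real \<Rightarrow> real" and a b :: real
  assumes disp: "is_dispersion ehat e"
    and even: "\<And>p. e (- p) = e p"
    and symm: "\<And>p1 p2. e (p1, p2) = e (p2, p1)"
    and unique_max: "\<And>p. p \<in> T2 \<Longrightarrow> p \<noteq> (pi, pi) \<Longrightarrow> e p < e (pi, pi)"
    and nondegenerate: "negative_definite (hessian e (pi, pi))"
    and analytic: "real_analytic_near e (pi, pi)"
    and a: "a \<noteq> 0"
    and b: "b \<noteq> 0"
  shows
    "(\<forall>\<omega>\<in>{OS, OA}. b > 0 \<longrightarrow>
        Phi e \<omega> \<in> Lr_sector 1 \<omega> - Lr_sector 2 \<omega> \<and>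
        threshold_solution e a b \<omega> (Phi e \<omega>)) \<and>
     (b > 0 \<longrightarrow>
        Phi e EA \<in> Lr_sector 2 EA \<and>
        threshold_solution e a b EA (Phi e EA)) \<and>
     ((a + 4 * b) / (a * b) > 0 \<and> Theta1 e * a = Theta2 e * b \<longrightarrow>
        Phi e ES \<in> Lr_sector 2 ES \<and>
        threshold_solution e a b ES (Phi e ES)) \<and>
     ((a + 4 * b) / (a * b) > 0 \<and> Theta1 e * a \<noteq> Theta2 e * b \<longrightarrow>
        (\<forall>f\<in>Lr_sector 1 ES.
           threshold_solution e a b ES f \<longleftrightarrow> (AE p in torus. f p = 0)))"
proof -
  obtain c C where c: "c > 0" "C > 0"
    and lo: "\<And>p. p \<in> T2 \<Longrightarrow> c * profile ES p \<le> emax e - e p"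
    and hi: "\<And>p. p \<in> T2 \<Longrightarrow> emax e - e p \<le> C * profile ES p"
    using gap_comparison[OF disp even unique_max nondegenerate analytic] by blast
  interpret threshold_gap e c C
  proof
    show "0 < emax e - e p" if "p \<in> T2" "p \<noteq> (pi, pi)" for p
      using unique_max[OF that] emax_eq[of e, OF unique_max] by simp
  qed (fact dispersion_continuous[OF disp] even symm c lo hi)+
  show ?thesis
  proof (intro conjI ballI impI)
    fix \<omega> assume \<omega>: "\<omega> \<in> {OS, OA}"
    then show "Phi e \<omega> \<in> Lr_sector 1 \<omega> - Lr_sector 2 \<omega>"
      using Phi_L1 Phi_not_L2_odd by blast
    show "threshold_solution e a b \<omega> (Phi e \<omega>)"
      by (rule Phi_solution) (use \<omega> b in auto)
  next
    show "Phi e EA \<in> Lr_sector 2 EA" "Phi e ES \<in> Lr_sector 2 ES"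
      by (rule Phi_L2_even; simp)+
    show "threshold_solution e a b EA (Phi e EA)"
      by (rule Phi_solution) (use b in auto)
  next
    assume "(a + 4 * b) / (a * b) > 0 \<and> Theta1 e * a = Theta2 e * b"
    then show "threshold_solution e a b ES (Phi e ES)"
      using Phi_ES_solution[OF a b] by blast
  next
    fix f
    assume h: "(a + 4 * b) / (a * b) > 0 \<and> Theta1 e * a \<noteq> Theta2 e * b"
      and f: "f \<in> Lr_sector 1 ES"
    show "threshold_solution e a b ES f \<longleftrightarrow> (AE p in torus. f p = 0)"
      using only_zero_solution[OF a b] zero_solution[OF f] h by blast
  qed
qed

end
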